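(* Let $M$ be a perfect matching with an even number of edges, whose vertex set is in general position (no three collinear), and which is convex-hull-connected. Then there is a perfect matching that is disjoint from and compatible with $M$.
   Context: A geometric graph has straight-segment edges joining points of its vertex set; it is non-crossing if two edges meet at most in a common endpoint. A perfect matching is a non-crossing geometric graph in which every vertex has degree exactly one. A set of pairwise disjoint segments (here the segments of $M$) is convex-hull-connected if every segment has at least one endpoint on the boundary of the convex hull of the union of the segments. Two non-crossing geometric graphs are compatible if they have the same vertex set and their union is non-crossing, and disjoint if they share no edge. *)

theory Defs
  imports "HOL-Analysis.Analysis"
begin

text \<open>An edge is represented by the set of its two endpoints; the segment it spans is
  \<open>edge_segment\<close>, which is \<open>closed_segment p q\<close> for \<open>e = {p, q}\<close>.\<close>

type_synonym point = "real ^ 2"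

record geo_graph =
  verts :: "point set"
  edges :: "point set set"

definition edge_segment :: "point set \<Rightarrow> point set" where
  "edge_segment e = convex hull e"

lemma edge_segment_pair: "edge_segment {p, q} = closed_segment p q"
  by (simp add: edge_segment_def segment_convex_hull)

definition geometric_graph :: "geo_graph \<Rightarrow> bool" where
  "geometric_graph G \<longleftrightarrow> finite (verts G) \<and>
     (\<forall>e\<in>edges G. \<exists>p\<in>verts G. \<exists>q\<in>verts G. p \<noteq> q \<and> e = {p, q})"

definition non_crossing :: "geo_graph \<Rightarrow> bool" where
  "non_crossing G \<longleftrightarrow>
     (\<forall>e\<in>edges G. \<forall>f\<in>edges G. e \<noteq> f \<longrightarrow> edge_segment e \<inter> edge_segment f \<subseteq> e \<inter> f)"

definition degree :: "geo_graph \<Rightarrow> point \<Rightarrow> nat" where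
  "degree G v = card {e \<in> edges G. v \<in> e}"

definition perfect_matching :: "geo_graph \<Rightarrow> bool" where
  "perfect_matching G \<longleftrightarrow>
     geometric_graph G \<and> non_crossing G \<and> (\<forall>v\<in>verts G. degree G v = 1)"

definition general_position :: "point set \<Rightarrow> bool" where
  "general_position V \<longleftrightarrow> (\<forall>A\<subseteq>V. card A = 3 \<longrightarrow> \<not> collinear A)"

text \<open>The argument is a set of segments, each given by its pair of endpoints. For the edges of a
  perfect matching these segments are pairwise disjoint, see \<open>perfect_matching_disjoint_segments\<close>.\<close>

definition convex_hull_connected :: "point set set \<Rightarrow> bool" where
  "convex_hull_connected S \<longleftrightarrow>
     (\<forall>e\<in>S. \<exists>p\<in>e. p \<in> frontier (convex hull (\<Union>f\<in>S. edge_segment f)))"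

definition graph_union :: "geo_graph \<Rightarrow> geo_graph \<Rightarrow> geo_graph" where
  "graph_union G H = \<lparr>verts = verts G \<union> verts H, edges = edges G \<union> edges H\<rparr>"

definition compatible :: "geo_graph \<Rightarrow> geo_graph \<Rightarrow> bool" where
  "compatible G H \<longleftrightarrow>
     geometric_graph G \<and> non_crossing G \<and> geometric_graph H \<and> non_crossing H \<and>
     verts G = verts H \<and> non_crossing (graph_union G H)"

definition edge_disjoint :: "geo_graph \<Rightarrow> geo_graph \<Rightarrow> bool" where
  "edge_disjoint G H \<longleftrightarrow> edges G \<inter> edges H = {}"

lemma perfect_matching_disjoint_segments:
  assumes G: "perfect_matching G" and e: "e \<in> edges G" and f: "f \<in> edges G" and ne: "e \<noteq> f"
  shows "edge_segment e \<inter> edge_segment f = {}"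
proof -
  have "v \<notin> f" if v: "v \<in> e" for v
  proof
    assume vf: "v \<in> f"
    have gg: "geometric_graph G" and deg: "\<forall>v\<in>verts G. degree G v = 1"
      using G by (simp_all add: perfect_matching_def)
    from gg e obtain p q where "p \<in> verts G" "q \<in> verts G" "e = {p, q}"
      unfolding geometric_graph_def by metis
    with v have "v \<in> verts G" by auto
    with deg have "card {e \<in> edges G. v \<in> e} = 1"
      by (simp add: degree_def)
    then obtain a where a: "{e \<in> edges G. v \<in> e} = {a}"
      by (rule card_1_singletonE)
    have "e \<in> {e \<in> edges G. v \<in> e}" "f \<in> {e \<in> edges G. v \<in> e}"
      using e f v vf by simp_all
    then have "e = a" "f = a" unfolding a by simp_all
    with ne show False by simp
  qed
  then have "e \<inter> f = {}" by auto
  moreover have "edge_segment e \<inter> edge_segment f \<subseteq> e \<inter> f"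
    using G e f ne by (simp add: perfect_matching_def non_crossing_def)
  ultimately show ?thesis by simp
qed

end

theory Submission
  imports Defs
begin

text \<open>If a segment of the matching joins two vertices of the convex hull without being a hull edge,
  it splits the remaining segments into two sides, one with an even and one with an odd number of
  segments; the chord is given to the odd side, and induction applies to both.

  Otherwise every segment either has exactly one endpoint on the hull or is a hull edge. Contracting
  the segments turns the boundary of the hull into a cycle of even length, so alternate hull edges
  match one (red) endpoint of each segment. For the remaining (blue) endpoints, one per segment, take
  a set of edges of their visibility graph with odd degree at every blue point and of least total
  length. A crossing, or two edges at a vertex on the same side of its segment, could be replaced by
  shorter paths around the segment tips inside a triangle, and these tips are blue because they are
  not on the hull. So the set is a non-crossing perfect matching of the blue points. As each segment
  has one red and one blue endpoint, no segment is used.\<close>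

section \<open>Triangles and visibility\<close>

text \<open>Both matchings are found as odd subgraphs instead of by following a path or a cycle.
  \<open>odd_ends\<close> is the boundary map modulo 2 and symmetric difference is addition, so
  paths can be joined and exchanged without excluding repeated vertices or edges. Degree one comes
  afterwards: from the geometry of the hull for red edges, from minimality for blue ones. The cyclic
  order along the hull is never constructed.

  A set of least length exists only if the visibility graph of the blue points has some subgraph
  that is odd at every blue point. It is assembled from the red edges: a red edge \<open>hk\<close>
  gives a detour \<open>q h k q'\<close> between the blue partners of \<open>h\<close> and
  \<open>k\<close>, and pulling it tight leaves a blue path. The same lemma on pulling tight serves
  here and in the exchange arguments. Its triangle \<open>a x b\<close> has an apex \<open>x\<close>
  that need not be a vertex, because at a crossing it is the crossing point; the condition on it is
  that a segment entering the triangle avoids the sides \<open>ax\<close> and \<open>xb\<close>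
  outside \<open>a\<close> and \<open>b\<close>.\<close>

definition cross2 :: "point \<Rightarrow> point \<Rightarrow> real" where
  "cross2 u v = u $ 1 * v $ 2 - u $ 2 * v $ 1"

definition in_gen_pos :: "point set \<Rightarrow> bool" where
  "in_gen_pos V \<longleftrightarrow>
     (\<forall>a\<in>V. \<forall>b\<in>V. \<forall>c\<in>V. a \<noteq> b \<longrightarrow> a \<noteq> c \<longrightarrow> b \<noteq> c \<longrightarrow> cross2 (b - a) (c - a) \<noteq> 0)"

lemma in_gen_posD:
  "in_gen_pos V \<Longrightarrow> a \<in> V \<Longrightarrow> b \<in> V \<Longrightarrow> c \<in> V \<Longrightarrow> a \<noteq> b \<Longrightarrow> a \<noteq> c \<Longrightarrow> b \<noteq> c
    \<Longrightarrow> cross2 (b - a) (c - a) \<noteq> 0"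
  unfolding in_gen_pos_def by blast

lemma in_gen_pos_mono: "in_gen_pos V \<Longrightarrow> W \<subseteq> V \<Longrightarrow> in_gen_pos W"
  unfolding in_gen_pos_def by blast

lemma in_gen_pos_open_segment:
  assumes "in_gen_pos V" "a \<in> V" "b \<in> V" "c \<in> V"
  shows "c \<notin> open_segment a b"
proof
  assume c: "c \<in> open_segment a b"
  then obtain t where t: "c = (1 - t) *\<^sub>R a + t *\<^sub>R b" and ab: "a \<noteq> b"
    by (auto simp: in_segment)
  have "c \<noteq> a" "c \<noteq> b" using c by (auto simp: open_segment_def)
  moreover have "cross2 (b - a) (c - a) = 0"
    unfolding t cross2_def by (simp add: algebra_simps)
  ultimately show False using in_gen_posD[OF assms] ab by metis
qed

lemma vec2_eq_iff: "(u::point) = v \<longleftrightarrow> u $ 1 = v $ 1 \<and> u $ 2 = v $ 2"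
  by (metis exhaust_2 vec_eq_iff)

text \<open>Cramer's rule in the basis \<open>u\<close>, \<open>w\<close>.\<close>

lemma cross2_coords:
  assumes "cross2 u w \<noteq> 0"
  shows "p = (cross2 p w / cross2 u w) *\<^sub>R u + (cross2 u p / cross2 u w) *\<^sub>R w"
proof -
  have "cross2 u w *\<^sub>R p = cross2 p w *\<^sub>R u + cross2 u p *\<^sub>R w"
    by (simp add: vec2_eq_iff cross2_def algebra_simps)
  then have "(1 / cross2 u w) *\<^sub>R (cross2 u w *\<^sub>R p) = (1 / cross2 u w) *\<^sub>R (cross2 p w *\<^sub>R u + cross2 u p *\<^sub>R w)"
    by simp
  then show ?thesis using assms by (simp add: scaleR_add_right)
qed

definition open_triangle :: "point \<Rightarrow> point \<Rightarrow> point \<Rightarrow> point set" where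
  "open_triangle a x b =
     {x + s *\<^sub>R (a - x) + t *\<^sub>R (b - x) | s t. 0 < s \<and> 0 < t \<and> s + t < 1}"

text \<open>\<open>S\<close> and \<open>T\<close> are the barycentric weights of \<open>a\<close>
  and \<open>b\<close>; the weight of \<open>x\<close> is \<open>1 - S - T\<close>. The base
  \<open>ab\<close> lies on the line \<open>S + T = 1\<close>, the sides at \<open>x\<close> on the
  zero sets of \<open>S\<close> and \<open>T\<close>.\<close>

lemma triangle_coords:
  assumes "cross2 (a - x) (b - x) \<noteq> 0"
  obtains S T :: "point \<Rightarrow> real" where
    "\<And>p q t. S ((1 - t) *\<^sub>R p + t *\<^sub>R q) = (1 - t) * S p + t * S q"
    "\<And>p q t. T ((1 - t) *\<^sub>R p + t *\<^sub>R q) = (1 - t) * T p + t * T q"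
    "S a = 1" "S x = 0" "S b = 0" "T a = 0" "T x = 0" "T b = 1"
    "\<And>p. p = x + S p *\<^sub>R (a - x) + T p *\<^sub>R (b - x)"
    "\<And>p. p \<in> open_triangle a x b \<longleftrightarrow> 0 < S p \<and> 0 < T p \<and> S p + T p < 1"
proof
  let ?D = "cross2 (a - x) (b - x)"
  let ?S = "\<lambda>p. cross2 (p - x) (b - x) / ?D" and ?T = "\<lambda>p. cross2 (a - x) (p - x) / ?D"
  show S: "?S ((1 - t) *\<^sub>R p + t *\<^sub>R q) = (1 - t) * ?S p + t * ?S q" for p q t
    using assms by (simp add: field_simps) (simp add: cross2_def algebra_simps)
  show T: "?T ((1 - t) *\<^sub>R p + t *\<^sub>R q) = (1 - t) * ?T p + t * ?T q" for p q t
    using assms by (simp add: field_simps) (simp add: cross2_def algebra_simps)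
  show "?S a = 1" "?S x = 0" "?S b = 0" "?T a = 0" "?T x = 0" "?T b = 1"
    using assms by (simp_all add: cross2_def)
  show P: "p = x + ?S p *\<^sub>R (a - x) + ?T p *\<^sub>R (b - x)" for p
    using cross2_coords[OF assms, of "p - x"] by (simp add: algebra_simps)
  have "?S (x + s *\<^sub>R (a - x) + t *\<^sub>R (b - x)) = s" for s t
    using assms by (simp add: field_simps) (simp add: cross2_def algebra_simps)
  moreover have "?T (x + s *\<^sub>R (a - x) + t *\<^sub>R (b - x)) = t" for s t
    using assms by (simp add: field_simps) (simp add: cross2_def algebra_simps)
  ultimately show "p \<in> open_triangle a x b \<longleftrightarrow> 0 < ?S p \<and> 0 < ?T p \<and> ?S p + ?T p < 1" for p
    using P[of p] unfolding open_triangle_def by (smt (verit, best) mem_Collect_eq)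
qed

text \<open>The hypothesis under which \<open>a x b\<close> can be pulled tight. Only segments that
  reach the interior are restricted: a segment may run along a side or through \<open>x\<close> if
  it stays outside the open triangle.\<close>

definition unobstructed :: "point set set \<Rightarrow> point \<Rightarrow> point \<Rightarrow> point \<Rightarrow> bool" where
  "unobstructed E a x b \<longleftrightarrow>
     (\<forall>e\<in>E. edge_segment e \<inter> open_triangle a x b \<noteq> {} \<longrightarrow>
        edge_segment e \<inter> (closed_segment a x \<union> closed_segment x b) \<subseteq> {a, b})"

text \<open>Contact at \<open>p\<close> and \<open>q\<close> is permitted because they are usually
  endpoints of segments themselves. By the exception \<open>e = {p, q}\<close> a segment does not
  hide its two endpoints from each other.\<close>

definition sees :: "point set set \<Rightarrow> point \<Rightarrow> point \<Rightarrow> bool" where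
  "sees E p q \<longleftrightarrow> (\<forall>e\<in>E. e \<noteq> {p, q} \<longrightarrow> edge_segment e \<inter> closed_segment p q \<subseteq> {p, q})"

definition visible_edges :: "point set set \<Rightarrow> point set \<Rightarrow> point set set" where
  "visible_edges E W = {{p, q} | p q. p \<in> W \<and> q \<in> W \<and> p \<noteq> q \<and> sees E p q}"

text \<open>The intermediate value theorem for the minimum of two affine functions: at
  \<open>l\<close> both coordinates are nonnegative and one of them vanishes, so the moving point is
  on the boundary of the cone at the apex.\<close>

lemma first_exit:
  fixes s0 t0 s1 t1 :: real
  assumes "0 < s0" "0 < t0" "s1 \<le> 0 \<or> t1 \<le> 0"
  obtains l where "0 < l" "l \<le> 1" "min ((1 - l) * s0 + l * s1) ((1 - l) * t0 + l * t1) = 0"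
proof -
  let ?h = "\<lambda>l. min ((1 - l) * s0 + l * s1) ((1 - l) * t0 + l * t1)"
  have "\<exists>l\<ge>0. l \<le> 1 \<and> ?h l = 0"
    by (rule IVT2') (use assms in \<open>auto intro!: continuous_intros simp: min_le_iff_disj\<close>)
  then obtain l where l: "0 \<le> l" "l \<le> 1" "?h l = 0" by blast
  have "l \<noteq> 0" using l(3) assms by (auto simp: min_def split: if_splits)
  then show ?thesis using that[OF _ l(2,3)] l(1) by simp
qed

text \<open>If \<open>c\<close> were strictly on the apex side of the line \<open>ab\<close>, the
  segment would run from \<open>y\<close> through the triangle and leave it across \<open>ax\<close>
  or \<open>xb\<close>, which \<open>un\<close> forbids. The coordinates are hypotheses so that
  callers can go on computing with the same \<open>S\<close> and \<open>T\<close>.\<close>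

lemma blocked_at_base:
  assumes nz: "cross2 (a - x) (b - x) \<noteq> 0" and un: "unobstructed E a x b"
    and e: "{c, d} \<in> E" and c: "c \<notin> open_triangle a x b"
    and y: "y \<in> closed_segment c d" "y \<in> open_segment a b"
    and Saff: "\<And>p q t. S ((1 - t) *\<^sub>R p + t *\<^sub>R q) = (1 - t) * S p + t * S q"
    and Taff: "\<And>p q t. T ((1 - t) *\<^sub>R p + t *\<^sub>R q) = (1 - t) * T p + t * T q"
    and vals: "S a = 1" "S x = 0" "S b = 0" "T a = 0" "T x = 0" "T b = 1"
    and P: "\<And>p. p = x + S p *\<^sub>R (a - x) + T p *\<^sub>R (b - x)"
    and tri: "\<And>p. p \<in> open_triangle a x b \<longleftrightarrow> 0 < S p \<and> 0 < T p \<and> S p + T p < 1"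
  shows "S c + T c \<ge> (1::real)"
proof (rule ccontr)
  assume neg: "\<not> S c + T c \<ge> 1"
  obtain u where u: "0 < u" "u < 1" "y = (1 - u) *\<^sub>R a + u *\<^sub>R b"
    using y(2) by (auto simp: in_segment)
  have Sy: "S y = 1 - u" and Ty: "T y = u" using u by (simp_all add: Saff Taff vals)
  obtain l where l: "0 < l" "l \<le> 1"
    and m: "min ((1 - l) * S y + l * S c) ((1 - l) * T y + l * T c) = 0"
    by (rule first_exit[of "S y" "T y" "S c" "T c"]) (use Sy Ty u c[unfolded tri] neg in linarith)+
  define z where "z = (1 - l) *\<^sub>R y + l *\<^sub>R c"
  have Sz: "S z = (1 - l) * S y + l * S c" and Tz: "T z = (1 - l) * T y + l * T c"
    by (simp_all add: z_def Saff Taff)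
  have "S z + T z = (1 - l) * (S y + T y) + l * (S c + T c)" by (simp add: Sz Tz algebra_simps)
  also have "\<dots> < 1" using l neg Sy Ty mult_strict_left_mono[of "S c + T c" 1 l] by simp
  finally have fz: "S z + T z < 1" .
  have z0: "S z \<ge> 0" "T z \<ge> 0" "S z = 0 \<or> T z = 0"
    using m unfolding Sz Tz by (auto simp: min_def split: if_splits)
  \<comment> \<open>The midpoint of \<open>y\<close> and the exit point \<open>z\<close> shows that
    the segment meets the open triangle.\<close>
  define m where "m = (1 - 1/2) *\<^sub>R y + (1/2::real) *\<^sub>R z"
  have "S m = (S y + S z) / 2" "T m = (T y + T z) / 2" unfolding m_def Saff Taff by simp_all
  then have "m \<in> open_triangle a x b"
    unfolding tri using z0(1,2) fz Sy Ty u(1,2) by auto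
  moreover have "z \<in> closed_segment c d"
  proof -
    have "z \<in> closed_segment y c" using l less_imp_le[OF l(1)] unfolding z_def in_segment by blast
    then show ?thesis using y(1) by (meson ends_in_segment(1) subset_closed_segment subsetD)
  qed
  moreover have "m \<in> closed_segment c d"
  proof -
    have "m \<in> closed_segment y z" unfolding m_def in_segment by (rule exI[of _ "1/2"]) auto
    then show ?thesis using y(1) \<open>z \<in> closed_segment c d\<close>
      by (meson subset_closed_segment subsetD)
  qed
  moreover have "z \<in> closed_segment a x \<union> closed_segment x b"
  proof (cases "S z = 0")
    case True
    then have "z = (1 - T z) *\<^sub>R x + T z *\<^sub>R b" using P[of z] by (simp add: algebra_simps)
    then show ?thesis using z0 fz True by (auto simp: in_segment)
  next
    case False
    then have "z = (1 - (1 - S z)) *\<^sub>R a + (1 - S z) *\<^sub>R x" using P[of z] z0 by (simp add: algebra_simps)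
    then have "z \<in> closed_segment a x" using z0 fz unfolding in_segment by (intro exI[of _ "1 - S z"]) auto
    then show ?thesis by blast
  qed
  moreover have "z \<noteq> a" "z \<noteq> b" using fz vals by auto
  ultimately show False
    using un e unfolding unobstructed_def edge_segment_pair[symmetric] by blast
qed

text \<open>\<open>aff\<close> combines only two points, but for every real \<open>t\<close>; so the
  point is written as the midpoint of two points extrapolated with the factors \<open>2 * s\<close>
  and \<open>2 * t\<close>.\<close>

lemma affine_triangle:
  fixes S :: "point \<Rightarrow> real"
  assumes aff: "\<And>p q t. S ((1 - t) *\<^sub>R p + t *\<^sub>R q) = (1 - t) * S p + t * S q"
  shows "S (x + s *\<^sub>R (a - x) + t *\<^sub>R (b - x)) = S x + s * (S a - S x) + t * (S b - S x)"
proof -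
  have "x + s *\<^sub>R (a - x) + t *\<^sub>R (b - x) =
      (1 - 1/2) *\<^sub>R ((1 - 2 * s) *\<^sub>R x + (2 * s) *\<^sub>R a)
        + (1/2::real) *\<^sub>R ((1 - 2 * t) *\<^sub>R x + (2 * t) *\<^sub>R b)"
    by (simp add: vec2_eq_iff) (simp add: field_simps)
  then show ?thesis by (simp only: aff) (simp add: algebra_simps)
qed

lemma sees_along_empty_triangle:
  assumes gp: "in_gen_pos (\<Union>E)" and pairs: "\<And>e. e \<in> E \<Longrightarrow> \<exists>p q. p \<noteq> q \<and> e = {p, q}"
    and nz: "cross2 (a - x) (b - x) \<noteq> 0" and un: "unobstructed E a x b"
    and empty: "\<Union>E \<inter> open_triangle a x b = {}"
    and a: "a \<in> \<Union>E" and c: "c \<in> \<Union>E" "c \<in> open_segment a b \<or> c = b"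
  shows "sees E a c"
  unfolding sees_def
proof (intro ballI impI subsetI, rule ccontr)
  fix e y
  assume e: "e \<in> E" "e \<noteq> {a, c}" and y: "y \<in> edge_segment e \<inter> closed_segment a c"
    and yn: "y \<notin> {a, c}"
  obtain p q where pq: "p \<noteq> q" "e = {p, q}" using pairs[OF e(1)] by blast
  have pV: "p \<in> \<Union>E" "q \<in> \<Union>E" using e pq by auto
  obtain S T where ST:
    "\<And>p q t. S ((1 - t) *\<^sub>R p + t *\<^sub>R q) = (1 - t) * S p + t * S q"
    "\<And>p q t. T ((1 - t) *\<^sub>R p + t *\<^sub>R q) = (1 - t) * T p + t * T q"
    "S a = 1" "S x = 0" "S b = 0" "T a = 0" "T x = 0" "T b = 1"
    "\<And>p. p = x + S p *\<^sub>R (a - x) + T p *\<^sub>R (b - x)"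
    "\<And>p. p \<in> open_triangle a x b \<longleftrightarrow> 0 < S p \<and> 0 < T p \<and> S p + T p < 1"
    using triangle_coords[OF nz] by blast
  have y_ac: "y \<in> open_segment a c" using y yn by (auto simp: open_segment_def)
  have "open_segment a c \<subseteq> open_segment a b"
    using c(2) by (metis empty_subsetI ends_in_segment(1) equalityD1 open_segment_idem
      segment_open_subset_closed subset_open_segment subsetD)
  then have y_ab: "y \<in> open_segment a b" using y_ac by blast
  have y_pq: "y \<in> closed_segment p q" "y \<in> closed_segment q p"
    using y pq by (auto simp: edge_segment_pair closed_segment_commute)
  have p1: "S p + T p \<ge> 1"
    by (rule blocked_at_base[OF nz un _ _ y_pq(1) y_ab ST]) (use e pq pV empty in auto)
  have q1: "S q + T q \<ge> 1"
    by (rule blocked_at_base[OF nz un _ _ y_pq(2) y_ab ST]) (use e pq pV empty in \<open>auto simp: insert_commute\<close>)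
  obtain u where u: "0 < u" "u < 1" "y = (1 - u) *\<^sub>R a + u *\<^sub>R b"
    using y_ab by (auto simp: in_segment)
  have y1: "S y + T y = 1" unfolding u(3) ST(1,2) using ST(3-8) by simp
  have "y \<noteq> p" "y \<noteq> q"
    using in_gen_pos_open_segment[OF gp a c(1)] pV y_ac by auto
  then obtain v where v: "0 < v" "v < 1" "y = (1 - v) *\<^sub>R p + v *\<^sub>R q"
    using y_pq(1) by (metis DiffI empty_iff in_segment(2) insert_iff open_segment_def)
  have "(1 - v) * (S p + T p) + v * (S q + T q) = 1"
    using y1 unfolding v(3) ST(1,2) by (simp add: algebra_simps)
  then have "(1 - v) * (S p + T p - 1) + v * (S q + T q - 1) = 0" by (simp add: algebra_simps)
  moreover have "(1 - v) * (S p + T p - 1) \<ge> 0" "v * (S q + T q - 1) \<ge> 0" using v p1 q1 by auto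
  ultimately have "(1 - v) * (S p + T p - 1) = 0" "v * (S q + T q - 1) = 0" by linarith+
  then have "S p + T p = 1" "S q + T q = 1" using v by auto
  moreover have "r = a \<or> r = c" if r: "r \<in> \<Union>E" and r1: "S r + T r = 1" for r
  proof (rule ccontr)
    assume rn: "\<not> (r = a \<or> r = c)"
    have "S r = 1 - T r" using r1 by simp
    then have "r = x + (1 - T r) *\<^sub>R (a - x) + T r *\<^sub>R (b - x)" using ST(9)[of r] by metis
    also have "\<dots> = a + T r *\<^sub>R (b - a)" by (simp add: algebra_simps)
    finally have r2: "r - a = T r *\<^sub>R (b - a)" by (simp add: algebra_simps)
    have "\<exists>w. c - a = w *\<^sub>R (b - a)"
    proof -
      have "c \<in> closed_segment a b" using c(2) by (auto simp: open_segment_def)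
      then obtain w where "c = (1 - w) *\<^sub>R a + w *\<^sub>R b" by (auto simp: in_segment)
      then have "c - a = w *\<^sub>R (b - a)" by (simp add: algebra_simps)
      then show ?thesis by blast
    qed
    then obtain w where w: "c - a = w *\<^sub>R (b - a)" by blast
    have "cross2 (c - a) (r - a) = 0" unfolding w r2 by (simp add: cross2_def algebra_simps)
    moreover have "c \<noteq> a" using y_ac by auto
    ultimately show False using in_gen_posD[OF gp a c(1) r] rn by auto
  qed
  ultimately have "p = a \<or> p = c" "q = a \<or> q = c" using pV by auto
  then show False using e pq by (auto simp: insert_commute)
qed

section \<open>Boundaries modulo 2 and lengths\<close>

text \<open>The incidence map \<open>N\<close> is a parameter because two graphs are meant: points
  joined by visibility edges (\<open>N\<close> the identity) and segments joined by the hull edges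
  touching them (\<open>N\<close> is \<open>touched\<close>).\<close>

definition odd_ends :: "('e \<Rightarrow> 'v set) \<Rightarrow> 'e set \<Rightarrow> 'v set" where
  "odd_ends N X = {v. odd (card {e \<in> X. v \<in> N e})}"

lemma odd_ends_empty [simp]: "odd_ends N {} = {}"
  by (simp add: odd_ends_def)

lemma odd_ends_singleton [simp]: "odd_ends N {e} = N e"
proof -
  have "{f \<in> {e}. v \<in> N f} = (if v \<in> N e then {e} else {})" for v by auto
  then show ?thesis by (simp add: odd_ends_def)
qed

lemma odd_card_sym_diff:
  assumes "finite A" "finite B"
  shows "odd (card (sym_diff A B)) \<longleftrightarrow> odd (card A) \<noteq> odd (card B)"
proof -
  have "card (sym_diff A B) = card (A - B) + card (B - A)"
    using assms by (intro card_Un_disjoint) auto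
  moreover have "card A = card (A - B) + card (A \<inter> B)"
    using assms by (metis Diff_disjoint Int_Diff_Un Un_commute card_Un_disjoint finite_Diff finite_Int inf_commute Diff_Int_distrib2 Int_Diff inf_bot_right)
  moreover have "card B = card (B - A) + card (A \<inter> B)"
    using assms by (metis Diff_disjoint Int_Diff_Un Un_commute card_Un_disjoint finite_Diff finite_Int inf_commute Diff_Int_distrib2 Int_Diff inf_bot_right)
  ultimately show ?thesis by auto
qed

lemma odd_ends_sym_diff:
  assumes "finite X" "finite Y"
  shows "odd_ends N (sym_diff X Y) = sym_diff (odd_ends N X) (odd_ends N Y)"
proof -
  have "{e \<in> sym_diff X Y. v \<in> N e} = sym_diff {e \<in> X. v \<in> N e} {e \<in> Y. v \<in> N e}" for v
    by auto
  then have "odd (card {e \<in> sym_diff X Y. v \<in> N e}) \<longleftrightarrow>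
      odd (card {e \<in> X. v \<in> N e}) \<noteq> odd (card {e \<in> Y. v \<in> N e})" for v
    using odd_card_sym_diff[of "{e \<in> X. v \<in> N e}" "{e \<in> Y. v \<in> N e}"] assms by simp
  then show ?thesis unfolding odd_ends_def by auto
qed

text \<open>The double sum counts the distance of the endpoints twice and needs no choice of their
  order.\<close>

definition edge_length :: "point set \<Rightarrow> real" where
  "edge_length e = (\<Sum>p\<in>e. \<Sum>q\<in>e. dist p q) / 2"

lemma edge_length_pair [simp]: "edge_length {p, q} = dist p q"
  by (cases "p = q") (simp_all add: edge_length_def dist_commute)

lemma edge_length_nonneg: "0 \<le> edge_length e"
  by (simp add: edge_length_def sum_nonneg)

abbreviation total_length :: "point set set \<Rightarrow> real" where
  "total_length \<equiv> sum edge_length"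

lemma total_length_sym_diff_le:
  assumes "finite X" "finite Y"
  shows "total_length (sym_diff X Y) \<le> total_length X + total_length Y"
proof -
  have "total_length (sym_diff X Y) = total_length (X - Y) + total_length (Y - X)"
    using assms by (intro sum.union_disjoint) auto
  also have "\<dots> \<le> total_length X + total_length Y"
    using assms by (intro add_mono sum_mono2) (auto simp: edge_length_nonneg)
  finally show ?thesis .
qed

lemma visible_edges_mono: "W \<subseteq> W' \<Longrightarrow> visible_edges E W \<subseteq> visible_edges E W'"
  unfolding visible_edges_def by blast

lemma finite_visible_edges: "finite W \<Longrightarrow> finite (visible_edges E W)"
  by (rule finite_subset[of _ "Pow W"]) (auto simp: visible_edges_def)

text \<open>The shortest path from \<open>a\<close> to \<open>b\<close> homotopic to \<open>a x b\<close>, built from \<open>a\<close> on: its first edge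
  leads to the vertex \<open>c\<close> inside the triangle that is seen from \<open>a\<close> under the smallest angle with
  \<open>ax\<close>. The last edge \<open>rb\<close> is kept apart.\<close>

lemma shortcut:
  assumes gp: "in_gen_pos (\<Union>E)" and pairs: "\<And>e. e \<in> E \<Longrightarrow> \<exists>p q. p \<noteq> q \<and> e = {p, q}"
    and fin: "finite (\<Union>E)"
    and nz: "cross2 (a - x) (b - x) \<noteq> 0" and un: "unobstructed E a x b"
    and a: "a \<in> \<Union>E" and b: "b \<in> \<Union>E"
  shows "\<exists>r Y. r \<in> insert a (\<Union>E \<inter> open_triangle a x b) \<and> sees E r b \<and>
           Y \<subseteq> visible_edges E (insert a (\<Union>E \<inter> open_triangle a x b)) \<and>
           odd_ends (\<lambda>e. e) Y = sym_diff {a} {r} \<and>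
           total_length Y + dist r b < dist a x + dist x b"
  using nz un a
proof (induction "card (\<Union>E \<inter> open_triangle a x b)" arbitrary: a x rule: less_induct)
  case less
  note nz = less.prems(1) and un = less.prems(2) and a = less.prems(3)
  let ?I = "\<Union>E \<inter> open_triangle a x b"
  obtain S T where ST:
    "\<And>p q t. S ((1 - t) *\<^sub>R p + t *\<^sub>R q) = (1 - t) * S p + t * S q"
    "\<And>p q t. T ((1 - t) *\<^sub>R p + t *\<^sub>R q) = (1 - t) * T p + t * T q"
    "S a = 1" "S x = 0" "S b = 0" "T a = 0" "T x = 0" "T b = 1"
    "\<And>p. p = x + S p *\<^sub>R (a - x) + T p *\<^sub>R (b - x)"
    "\<And>p. p \<in> open_triangle a x b \<longleftrightarrow> 0 < S p \<and> 0 < T p \<and> S p + T p < 1"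
    using triangle_coords[OF nz] by blast
  \<comment> \<open>Only the empty triangle needs this strict inequality; otherwise strictness is
    inherited through the induction.\<close>
  have strict: "dist a b < dist a x + dist x b"
  proof -
    have "x \<notin> closed_segment a b"
    proof
      assume "x \<in> closed_segment a b"
      then obtain u where u: "x = (1 - u) *\<^sub>R a + u *\<^sub>R b" by (auto simp: in_segment)
      have "cross2 (a - x) (b - x) = 0" unfolding u by (simp add: cross2_def algebra_simps)
      with nz show False by simp
    qed
    then have "dist a b \<noteq> dist a x + dist x b" by (metis between between_mem_segment)
    then show ?thesis using dist_triangle[of a b x] by (simp add: dist_commute)
  qed
  show ?case
  proof (cases "?I = {}")
    case True
    have "sees E a b"
      by (rule sees_along_empty_triangle[OF gp pairs nz un True a b]) auto
    then show ?thesis using strict by (intro exI[of _ a] exI[of _ "{}"]) auto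
  next
    case False
    have finI: "finite ?I" using fin by blast
    \<comment> \<open>Constant along each ray from \<open>a\<close>, and equal to the fraction of
      \<open>xb\<close> at which the ray arrives; it grows as the ray turns from \<open>ax\<close>
      towards \<open>ab\<close>.\<close>
    define slope where "slope = (\<lambda>p. T p / (1 - S p))"
    obtain c where c: "c \<in> ?I" and cmin: "\<And>p. p \<in> ?I \<Longrightarrow> slope c \<le> slope p"
      using False finI by (metis (no_types, lifting) arg_min_if_finite(1) arg_min_least)
    have cV: "c \<in> \<Union>E" and Sc: "0 < S c" "0 < T c" "S c + T c < 1" using c ST(10) by auto
    define k where "k = slope c"
    have k: "0 < k" "k < 1" using Sc by (auto simp: k_def slope_def divide_simps)
    \<comment> \<open>The point where the ray from \<open>a\<close> through \<open>c\<close> meets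
      \<open>xb\<close>. The triangle \<open>a x x'\<close> is free of vertices by the choice of
      \<open>c\<close>, so \<open>a\<close> sees \<open>c\<close>; the induction continues in
      \<open>c x' b\<close>.\<close>
    define x' where "x' = (1 - k) *\<^sub>R x + k *\<^sub>R b"
    have x'ST: "S x' = 0" "T x' = k" unfolding x'_def ST(1,2) using ST by simp_all
    have Tc: "T c = k * (1 - S c)" using Sc by (simp add: k_def slope_def)
    have c_ax': "c = (1 - (1 - S c)) *\<^sub>R a + (1 - S c) *\<^sub>R x'"
    proof -
      have "c = x + S c *\<^sub>R (a - x) + T c *\<^sub>R (b - x)" by (rule ST(9))
      also have "\<dots> = (1 - (1 - S c)) *\<^sub>R a + (1 - S c) *\<^sub>R x'"
        unfolding Tc x'_def by (simp add: algebra_simps)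
      finally show ?thesis .
    qed
    have ax': "a \<noteq> x'" using x'ST ST(3) by auto
    have c_open: "c \<in> open_segment a x'"
      unfolding in_segment using ax' c_ax' Sc by (intro conjI exI[of _ "1 - S c"]) auto
    have Dx': "cross2 (a - x) (x' - x) = k * cross2 (a - x) (b - x)"
      unfolding x'_def cross2_def by (simp add: algebra_simps)
    then have nz1: "cross2 (a - x) (x' - x) \<noteq> 0" using k nz by simp
    have tri1: "open_triangle a x x' \<subseteq> {p \<in> open_triangle a x b. slope p < k}"
    proof
      fix p assume "p \<in> open_triangle a x x'"
      then obtain s t where st: "0 < s" "0 < t" "s + t < 1"
        and p: "p = x + s *\<^sub>R (a - x) + t *\<^sub>R (x' - x)"
        by (auto simp: open_triangle_def)
      have p2: "p = x + s *\<^sub>R (a - x) + (t * k) *\<^sub>R (b - x)"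
        unfolding p x'_def by (simp add: algebra_simps)
      have "t * k < t" using st k by simp
      then have "s + t * k < 1" using st(3) by linarith
      moreover have "0 < t * k" using st k by simp
      ultimately have "p \<in> open_triangle a x b" unfolding open_triangle_def using st(1) p2 by blast
      moreover have "S p = s" "T p = t * k"
      proof -
        show "S p = s" unfolding p affine_triangle[OF ST(1)] using ST x'ST by simp
        show "T p = t * k" unfolding p affine_triangle[OF ST(2)] using ST x'ST by simp
      qed
      moreover have "t * k / (1 - s) < k" using st k by (simp add: divide_simps)
      ultimately show "p \<in> {p \<in> open_triangle a x b. slope p < k}" by (simp add: slope_def)
    qed
    have empty1: "\<Union>E \<inter> open_triangle a x x' = {}"
      using tri1 cmin unfolding k_def by fastforce
    have seg_x': "x' \<in> closed_segment x b" using k unfolding x'_def in_segment by (intro exI[of _ k]) auto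
    have sub_xx': "closed_segment x x' \<subseteq> closed_segment x b"
      and sub_x'b: "closed_segment x' b \<subseteq> closed_segment x b"
      using seg_x' by (simp_all add: subset_closed_segment)
    have b_notin: "b \<notin> closed_segment x x'"
    proof
      assume "b \<in> closed_segment x x'"
      then obtain u where u: "0 \<le> u" "u \<le> 1" "b = (1 - u) *\<^sub>R x + u *\<^sub>R x'" by (auto simp: in_segment)
      have "T b = (1 - u) * T x + u * T x'" by (subst u(3)) (rule ST(2))
      then have "1 = u * k" using ST x'ST by simp
      moreover have "u * k \<le> 1 * k" using u k by (intro mult_right_mono) auto
      ultimately show False using k by simp
    qed
    have b_notin2: "b \<notin> closed_segment a x"
    proof
      assume "b \<in> closed_segment a x"
      then obtain u where u: "b = (1 - u) *\<^sub>R a + u *\<^sub>R x" by (auto simp: in_segment)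
      have "T b = (1 - u) * T a + u * T x" by (subst u) (rule ST(2))
      then show False using ST by simp
    qed
    have un1: "unobstructed E a x x'"
      unfolding unobstructed_def
    proof (intro ballI impI)
      fix e assume e: "e \<in> E" "edge_segment e \<inter> open_triangle a x x' \<noteq> {}"
      then have "edge_segment e \<inter> (closed_segment a x \<union> closed_segment x b) \<subseteq> {a, b}"
        using un tri1 unfolding unobstructed_def by blast
      then show "edge_segment e \<inter> (closed_segment a x \<union> closed_segment x x') \<subseteq> {a, x'}"
        using sub_xx' b_notin b_notin2 by blast
    qed
    have sees_ac: "sees E a c"
      by (rule sees_along_empty_triangle[OF gp pairs nz1 un1 empty1 a cV]) (use c_open in auto)
    have nz2: "cross2 (c - x') (b - x') \<noteq> 0"
    proof -
      have e: "c - x' = S c *\<^sub>R (a - x')" using c_ax' by (simp add: algebra_simps)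
      have "cross2 (S c *\<^sub>R (a - x')) (b - x') = S c * (1 - k) * cross2 (a - x) (b - x)"
        unfolding x'_def cross2_def by (simp add: algebra_simps)
      then have "cross2 (c - x') (b - x') = S c * (1 - k) * cross2 (a - x) (b - x)" unfolding e .
      then show ?thesis using Sc k nz by simp
    qed
    \<comment> \<open>The next triangle lies strictly beyond the ray through \<open>c\<close>, so
      \<open>c\<close> drops out and fewer vertices are left inside.\<close>
    have tri2': "\<And>p. p \<in> open_triangle c x' b \<Longrightarrow> p \<in> open_triangle a x b - {c}"
      and off_line: "\<And>p. p \<in> open_triangle c x' b \<Longrightarrow> slope p > k \<and> S p < 1"
    proof -
      fix p assume "p \<in> open_triangle c x' b"
      then obtain s t where st: "0 < s" "0 < t" "s + t < 1"
        and p: "p = x' + s *\<^sub>R (c - x') + t *\<^sub>R (b - x')"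
        by (auto simp: open_triangle_def)
      have Sp: "S p = s * S c" unfolding p affine_triangle[OF ST(1)] using ST x'ST by simp
      have Tp: "T p = s * T c + (1 - s - t) * k + t"
        unfolding p affine_triangle[OF ST(2)] using ST x'ST by (simp add: algebra_simps)
      have sS: "s * S c < S c" "s * S c > 0" using st Sc by auto
      have Tp2: "T p = k * (1 - S p) + t * (1 - k)"
        unfolding Sp Tp Tc by (simp add: algebra_simps)
      have tk: "t * (1 - k) > 0" using st k by simp
      have Sp1: "S p < 1" using Sp sS Sc by linarith
      show sl: "slope p > k \<and> S p < 1"
        using Tp2 tk Sp1 by (simp add: slope_def pos_less_divide_eq)
      have "1 - (S p + T p) = s * (1 - S c - T c) + (1 - s - t) * (1 - k)"
        unfolding Sp Tp by (simp add: algebra_simps)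
      moreover have "s * (1 - S c - T c) > 0" "(1 - s - t) * (1 - k) > 0" using st Sc k by auto
      ultimately have "S p + T p < 1" by linarith
      moreover have "k * (1 - S p) > 0" using k Sp1 by simp
      ultimately have "p \<in> open_triangle a x b" unfolding ST(10) using Sp Tp2 sS tk by linarith
      moreover have "p \<noteq> c" using sl k_def by auto
      ultimately show "p \<in> open_triangle a x b - {c}" by blast
    qed
    have tri2: "open_triangle c x' b \<subseteq> open_triangle a x b - {c}" using tri2' by blast
    \<comment> \<open>The side \<open>x' b\<close> is part of \<open>xb\<close>. A segment meeting
      the new side \<open>c x'\<close> outside \<open>c\<close> lies on the line
      \<open>a x'\<close>, again by \<open>blocked_at_base\<close> in the empty triangle, and so
      misses the open triangle \<open>c x' b\<close>.\<close>
    have un2: "unobstructed E c x' b"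
      unfolding unobstructed_def
    proof (intro ballI impI subsetI)
      fix e z assume e: "e \<in> E" "edge_segment e \<inter> open_triangle c x' b \<noteq> {}"
        and z: "z \<in> edge_segment e \<inter> (closed_segment c x' \<union> closed_segment x' b)"
      have old: "edge_segment e \<inter> (closed_segment a x \<union> closed_segment x b) \<subseteq> {a, b}"
        using un e tri2 unfolding unobstructed_def by blast
      have a_notin: "a \<notin> closed_segment x b"
      proof
        assume "a \<in> closed_segment x b"
        then obtain u where u: "a = (1 - u) *\<^sub>R x + u *\<^sub>R b" by (auto simp: in_segment)
        have "S a = (1 - u) * S x + u * S b" by (subst u) (rule ST(1))
        then show False using ST by simp
      qed
      show "z \<in> {c, b}"
      proof (rule ccontr)
        assume zn: "z \<notin> {c, b}"
        have "z \<notin> closed_segment x b" using old z zn a_notin by blast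
        then have z1: "z \<in> closed_segment c x'" "z \<noteq> x'" using z sub_x'b seg_x' by auto
        have "z \<in> open_segment c x'" using z1 zn by (auto simp: open_segment_def)
        then have zo: "z \<in> open_segment a x'"
          using c_open by (meson ends_in_segment(2) open_closed_segment subset_open_segment subsetD)
        obtain p q where pq: "p \<noteq> q" "e = {p, q}" using pairs[OF e(1)] by blast
        have pV: "p \<in> \<Union>E" "q \<in> \<Union>E" using e pq by auto
        have zpq: "z \<in> closed_segment p q" "z \<in> closed_segment q p"
          using z pq by (auto simp: edge_segment_pair closed_segment_commute)
        obtain S' T' where ST':
          "\<And>p q t. S' ((1 - t) *\<^sub>R p + t *\<^sub>R q) = (1 - t) * S' p + t * S' q"
          "\<And>p q t. T' ((1 - t) *\<^sub>R p + t *\<^sub>R q) = (1 - t) * T' p + t * T' q"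
          "S' a = 1" "S' x = 0" "S' x' = 0" "T' a = 0" "T' x = 0" "T' x' = 1"
          "\<And>p. p = x + S' p *\<^sub>R (a - x) + T' p *\<^sub>R (x' - x)"
          "\<And>p. p \<in> open_triangle a x x' \<longleftrightarrow> 0 < S' p \<and> 0 < T' p \<and> S' p + T' p < 1"
          using triangle_coords[OF nz1] by blast
        \<comment> \<open>Since \<open>x' - x\<close> is \<open>k\<close> times
          \<open>b - x\<close>, passing to the triangle \<open>a x x'\<close> only rescales the
          second coordinate.\<close>
        have S'eq: "S' p = S p" and T'eq: "k * T' p = T p" for p
        proof -
          have e: "p = x + S' p *\<^sub>R (a - x) + (k * T' p) *\<^sub>R (b - x)"
            using ST'(9)[of p] unfolding x'_def by (simp add: algebra_simps)
          have "p - x = S p *\<^sub>R (a - x) + T p *\<^sub>R (b - x)" using ST(9)[of p] by (simp add: algebra_simps)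
          moreover have "p - x = S' p *\<^sub>R (a - x) + (k * T' p) *\<^sub>R (b - x)" using e by (simp add: algebra_simps)
          ultimately have d: "(S p - S' p) *\<^sub>R (a - x) + (T p - k * T' p) *\<^sub>R (b - x) = 0"
            by (simp add: algebra_simps)
          have "cross2 ((S p - S' p) *\<^sub>R (a - x) + (T p - k * T' p) *\<^sub>R (b - x)) (b - x) = (S p - S' p) * cross2 (a - x) (b - x)"
            by (simp add: cross2_def algebra_simps)
          moreover have "cross2 (a - x) ((S p - S' p) *\<^sub>R (a - x) + (T p - k * T' p) *\<^sub>R (b - x)) = (T p - k * T' p) * cross2 (a - x) (b - x)"
            by (simp add: cross2_def algebra_simps)
          ultimately show "S' p = S p" "k * T' p = T p"
            using d nz by (simp_all add: cross2_def)
        qed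
        define F where "F = (\<lambda>p. S' p + T' p)"
        have Faff: "F ((1 - t) *\<^sub>R p + t *\<^sub>R q) = (1 - t) * F p + t * F q" for p q t
          unfolding F_def ST'(1,2) by (simp add: algebra_simps)
        have Fp: "F p \<ge> 1" unfolding F_def
          by (rule blocked_at_base[OF nz1 un1 _ _ zpq(1) zo ST']) (use e pq pV empty1 in auto)
        have Fq: "F q \<ge> 1" unfolding F_def
          by (rule blocked_at_base[OF nz1 un1 _ _ zpq(2) zo ST']) (use e pq pV empty1 in \<open>auto simp: insert_commute\<close>)
        obtain u where u: "z = (1 - u) *\<^sub>R a + u *\<^sub>R x'" using zo by (auto simp: in_segment)
        have Fz: "F z = 1" unfolding u Faff unfolding F_def using ST'(3-8) by simp
        have zcol: "cross2 (c - a) (z - a) = 0"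
          by (subst c_ax') (simp add: u cross2_def algebra_simps)
        have za: "z \<noteq> a" "c \<noteq> a" using zo c_open by (auto simp: open_segment_def)
        have "z \<noteq> p" "z \<noteq> q"
          using in_gen_posD[OF gp a cV] zcol za zn pV by auto
        then obtain v where v: "0 < v" "v < 1" "z = (1 - v) *\<^sub>R p + v *\<^sub>R q"
          using zpq(1) by (metis DiffI empty_iff in_segment(2) insert_iff open_segment_def)
        have "(1 - v) * F p + v * F q = 1" using Fz unfolding v(3) Faff .
        then have "(1 - v) * (F p - 1) + v * (F q - 1) = 0" by (simp add: algebra_simps)
        moreover have "(1 - v) * (F p - 1) \<ge> 0" "v * (F q - 1) \<ge> 0" using v Fp Fq by auto
        ultimately have "(1 - v) * (F p - 1) = 0" "v * (F q - 1) = 0" by linarith+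
        then have F1: "F p = 1" "F q = 1" using v by auto
        obtain m where m: "m \<in> closed_segment p q" "m \<in> open_triangle c x' b"
          using e(2) pq by (auto simp: edge_segment_pair)
        obtain w where w: "m = (1 - w) *\<^sub>R p + w *\<^sub>R q" using m(1) by (auto simp: in_segment)
        have "F m = 1" unfolding w Faff F1 by simp
        then have "k * S m + T m = k" unfolding F_def S'eq T'eq[symmetric]
          by (metis distrib_left mult.right_neutral)
        then have "T m = k * (1 - S m)" by (simp add: algebra_simps)
        then show False using off_line[OF m(2)] by (simp add: slope_def split: if_splits)
      qed
    qed
    have less_card: "card (\<Union>E \<inter> open_triangle c x' b) < card ?I"
      using tri2 c finI by (intro psubset_card_mono) auto
    obtain r Y where r: "r \<in> insert c (\<Union>E \<inter> open_triangle c x' b)" "sees E r b"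
      and Y: "Y \<subseteq> visible_edges E (insert c (\<Union>E \<inter> open_triangle c x' b))"
        "odd_ends (\<lambda>e. e) Y = sym_diff {c} {r}"
        "total_length Y + dist r b < dist c x' + dist x' b"
      using less.hyps[OF less_card nz2 un2 cV] by blast
    have ac: "a \<noteq> c" using c_open by (auto simp: open_segment_def)
    have sub: "insert c (\<Union>E \<inter> open_triangle c x' b) \<subseteq> ?I" using tri2 c by blast
    have finY: "finite Y"
      using Y(1) finite_visible_edges[of "insert c (\<Union>E \<inter> open_triangle c x' b)"] fin
      by (meson finite_Int finite_insert finite_subset)
    let ?Y = "sym_diff {{a, c}} Y"
    have "odd_ends (\<lambda>e. e) ?Y = sym_diff {a, c} (sym_diff {c} {r})"
      using odd_ends_sym_diff[of "{{a, c}}" Y "\<lambda>e. e"] finY Y(2) by simp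
    also have "\<dots> = sym_diff {a} {r}" using ac by auto
    finally have o: "odd_ends (\<lambda>e. e) ?Y = sym_diff {a} {r}" .
    have "{a, c} \<in> visible_edges E (insert a ?I)"
      unfolding visible_edges_def using ac c sees_ac by blast
    then have v: "?Y \<subseteq> visible_edges E (insert a ?I)"
      using Y(1) visible_edges_mono[of "insert c (\<Union>E \<inter> open_triangle c x' b)" "insert a ?I" E] sub by blast
    \<comment> \<open>The path \<open>a c x'\<close> is straight and replaces \<open>a x x'\<close>,
      so the triangle inequality pays for the new edge \<open>ac\<close>.\<close>
    have "total_length ?Y \<le> dist a c + total_length Y"
      using total_length_sym_diff_le[of "{{a, c}}" Y] finY by simp
    moreover have "dist a c + dist c x' = dist a x'"
      using c_open by (metis between between_mem_segment open_closed_segment)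
    moreover have "dist x x' + dist x' b = dist x b"
      using seg_x' by (metis between between_mem_segment)
    moreover have "dist a x' \<le> dist a x + dist x x'" by (rule dist_triangle)
    ultimately have l: "total_length ?Y + dist r b < dist a x + dist x b" using Y(3) by linarith
    have "r \<in> insert a ?I" using r(1) sub by blast
    then show ?thesis using r(2) o v l by (intro exI[of _ r] exI[of _ ?Y] conjI)
  qed
qed

section \<open>A shortest odd subgraph of the visibility graph\<close>

locale disjoint_segments =
  fixes E :: "point set set"
  assumes finite_E: "finite E"
    and pairs: "e \<in> E \<Longrightarrow> \<exists>p q. p \<noteq> q \<and> e = {p, q}"
    and disj: "e \<in> E \<Longrightarrow> f \<in> E \<Longrightarrow> e \<noteq> f \<Longrightarrow> edge_segment e \<inter> edge_segment f = {}"
    and gp: "in_gen_pos (\<Union>E)"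
begin

lemma finite_V: "finite (\<Union>E)"
  using finite_E pairs by (metis finite.emptyI finite_Union finite_insert)

lemma endpoint_unique: "e \<in> E \<Longrightarrow> f \<in> E \<Longrightarrow> v \<in> e \<Longrightarrow> v \<in> edge_segment f \<Longrightarrow> e = f"
  using disj[of e f] unfolding edge_segment_def by (meson disjoint_iff hull_inc)

end

text \<open>\<open>inner_blue\<close> is all that the construction of shortened blue paths needs to
  know about the hull: every intermediate stop of such a path is blue, as long as the apex is in the
  hull.\<close>

locale blue_points = disjoint_segments +
  fixes B :: "point set"
  assumes blue: "e \<in> E \<Longrightarrow> \<exists>p q. p \<noteq> q \<and> e = {p, q} \<and> p \<in> B \<and> q \<notin> B"
    and B_sub: "B \<subseteq> \<Union>E"
    and inner_blue: "a \<in> \<Union>E \<Longrightarrow> b \<in> \<Union>E \<Longrightarrow> a \<noteq> b \<Longrightarrow> x \<in> convex hull (\<Union>E)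
      \<Longrightarrow> \<Union>E \<inter> open_triangle a x b \<subseteq> B"
begin

lemma finite_B: "finite B"
  using B_sub finite_V finite_subset by blast

lemma blue_pair_not_edge: "p \<in> B \<Longrightarrow> q \<in> B \<Longrightarrow> {p, q} \<notin> E"
  using blue[of "{p, q}"] by (auto simp: doubleton_eq_iff)

text \<open>Two blue points never form a segment, so the exception in \<open>sees\<close> does not
  arise.\<close>

lemma visible_edgeD:
  assumes "e \<in> visible_edges E B" "f \<in> E"
  shows "edge_segment f \<inter> edge_segment e \<subseteq> e"
proof -
  obtain p q where pq: "p \<in> B" "q \<in> B" "sees E p q" "e = {p, q}"
    using assms(1) by (auto simp: visible_edges_def)
  then have "f \<noteq> {p, q}" using blue_pair_not_edge assms(2) by blast
  then show ?thesis using pq assms(2) unfolding sees_def by (simp add: edge_segment_pair)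
qed

text \<open>With \<open>b\<close> blue as well, the edge \<open>rb\<close> that
  \<open>shortcut\<close> keeps apart is admissible and can be added.\<close>

lemma blue_shortcut:
  assumes nz: "cross2 (a - x) (b - x) \<noteq> 0" and un: "unobstructed E a x b"
    and a: "a \<in> B" and b: "b \<in> B" and x: "x \<in> convex hull (\<Union>E)"
  obtains Z where "Z \<subseteq> visible_edges E B" "odd_ends (\<lambda>e. e) Z = {a, b}"
    "total_length Z < dist a x + dist x b"
proof -
  have ab: "a \<noteq> b" using nz by (auto simp: cross2_def)
  have aV: "a \<in> \<Union>E" and bV: "b \<in> \<Union>E" using a b B_sub by auto
  have sub: "insert a (\<Union>E \<inter> open_triangle a x b) \<subseteq> B"
    using a inner_blue[OF aV bV ab x] by simp
  obtain r Y where r: "r \<in> insert a (\<Union>E \<inter> open_triangle a x b)" "sees E r b"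
    and Y: "Y \<subseteq> visible_edges E (insert a (\<Union>E \<inter> open_triangle a x b))"
      "odd_ends (\<lambda>e. e) Y = sym_diff {a} {r}"
      "total_length Y + dist r b < dist a x + dist x b"
    using shortcut[OF gp pairs finite_V nz un aV bV] by blast
  have "b \<notin> open_triangle a x b"
    by (rule triangle_coords[OF nz]) force
  then have rb: "r \<noteq> b" using r(1) ab by auto
  have Y': "Y \<subseteq> visible_edges E B" using Y(1) visible_edges_mono[OF sub] by blast
  have finY: "finite Y" using Y' finite_visible_edges[OF finite_B] finite_subset by blast
  let ?Z = "sym_diff Y {{r, b}}"
  have "{r, b} \<in> visible_edges E B"
    unfolding visible_edges_def using r b rb sub by blast
  then have "?Z \<subseteq> visible_edges E B" using Y' by blast
  moreover have "odd_ends (\<lambda>e. e) ?Z = sym_diff (sym_diff {a} {r}) {r, b}"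
    using odd_ends_sym_diff[of Y "{{r, b}}" "\<lambda>e. e"] finY Y(2) by simp
  then have "odd_ends (\<lambda>e. e) ?Z = {a, b}" using rb ab by auto
  moreover have "total_length ?Z < dist a x + dist x b"
    using total_length_sym_diff_le[of Y "{{r, b}}"] finY Y(3) by simp
  ultimately show ?thesis using that by blast
qed

text \<open>\<open>X0\<close> makes the finite family of candidates nonempty. The minimum is taken
  over all odd subgraphs, not over matchings, because an exchange need not preserve the matching
  property; only the parities are sure to survive.\<close>

lemma blue_matching:
  assumes X0: "X0 \<subseteq> visible_edges E B" "odd_ends (\<lambda>e. e) X0 = B"
  obtains X where "X \<subseteq> visible_edges E B"
    "\<And>e f. e \<in> X \<Longrightarrow> f \<in> X \<Longrightarrow> e \<noteq> f \<Longrightarrow> edge_segment e \<inter> edge_segment f \<subseteq> e \<inter> f"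
    "\<And>v. v \<in> B \<Longrightarrow> card {e \<in> X. v \<in> e} = 1"
proof -
  let ?F = "{X. X \<subseteq> visible_edges E B \<and> odd_ends (\<lambda>e. e) X = B}"
  have fin_vis: "finite (visible_edges E B)" by (rule finite_visible_edges[OF finite_B])
  then have "finite ?F" "?F \<noteq> {}" using X0 by auto
  then obtain X where "X \<in> ?F" and min0: "\<And>X'. X' \<in> ?F \<Longrightarrow> total_length X \<le> total_length X'"
    by (metis (no_types, lifting) arg_min_if_finite(1) arg_min_least)
  then have Xv: "X \<subseteq> visible_edges E B" and Xo: "odd_ends (\<lambda>e. e) X = B"
    by auto
  have finX: "finite X" using Xv fin_vis finite_subset by blast
  \<comment> \<open>Exchange principle: removing \<open>D\<close> and adding \<open>Z\<close> modulo
    2 keeps the boundary \<open>B\<close>, and cancellation can only shorten the result.\<close>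
  have optimal: "total_length D \<le> total_length Z"
    if D: "D \<subseteq> X" and Z: "Z \<subseteq> visible_edges E B" and DZ: "odd_ends (\<lambda>e. e) Z = odd_ends (\<lambda>e. e) D" for D Z
  proof -
    have finD: "finite D" using D finX finite_subset by blast
    have finZ: "finite Z" using Z fin_vis finite_subset by blast
    have "X - D = sym_diff X D" using D by auto
    then have "odd_ends (\<lambda>e. e) (X - D) = sym_diff B (odd_ends (\<lambda>e. e) D)"
      using odd_ends_sym_diff[OF finX finD, of "\<lambda>e. e"] Xo by simp
    then have "odd_ends (\<lambda>e. e) (sym_diff (X - D) Z) = B"
      using odd_ends_sym_diff[of "X - D" Z "\<lambda>e. e"] finX finZ DZ by auto
    moreover have "sym_diff (X - D) Z \<subseteq> visible_edges E B" using Xv Z by blast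
    ultimately have "total_length X \<le> total_length (sym_diff (X - D) Z)" by (intro min0) simp
    also have "\<dots> \<le> total_length (X - D) + total_length Z"
      using total_length_sym_diff_le finX finZ by blast
    also have "total_length (X - D) = total_length X - total_length D"
      using sum_diff[OF finX D] .
    finally show ?thesis by simp
  qed
  have X_edge: "\<exists>p q. p \<in> B \<and> q \<in> B \<and> p \<noteq> q \<and> e = {p, q}" if "e \<in> X" for e
    using that Xv unfolding visible_edges_def by blast
  have hull: "edge_segment e \<subseteq> convex hull (\<Union>E)" if "e \<in> X" for e
  proof -
    have "e \<subseteq> \<Union>E" using X_edge[OF that] B_sub by blast
    then show ?thesis unfolding edge_segment_def by (rule hull_mono)
  qed
  have noncross: "edge_segment e \<inter> edge_segment f \<subseteq> e \<inter> f"
    if e: "e \<in> X" and f: "f \<in> X" and ef: "e \<noteq> f" for e f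
  proof (rule ccontr)
    assume "\<not> edge_segment e \<inter> edge_segment f \<subseteq> e \<inter> f"
    then obtain z where z: "z \<in> edge_segment e" "z \<in> edge_segment f" and zn: "z \<notin> e \<inter> f" by blast
    obtain a b where ab: "a \<in> B" "b \<in> B" "a \<noteq> b" "e = {a, b}" using X_edge[OF e] by blast
    obtain c d where cd: "c \<in> B" "d \<in> B" "c \<noteq> d" "f = {c, d}" using X_edge[OF f] by blast
    have V: "a \<in> \<Union>E" "b \<in> \<Union>E" "c \<in> \<Union>E" "d \<in> \<Union>E" using ab cd B_sub by auto
    have zs: "z \<in> closed_segment a b" "z \<in> closed_segment c d"
      using z ab cd by (simp_all add: edge_segment_pair)
    note nov = in_gen_pos_open_segment[OF gp]
    have "z \<notin> e"
    proof
      assume "z \<in> e"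
      then have "z \<in> \<Union>E" "z \<notin> f" using zn ab V by auto
      then show False using nov[OF V(3,4)] zs(2) cd by (auto simp: open_segment_def)
    qed
    have "z \<notin> f"
    proof
      assume "z \<in> f"
      then have "z \<in> \<Union>E" "z \<notin> e" using zn cd V by auto
      then show False using nov[OF V(1,2)] zs(1) ab by (auto simp: open_segment_def)
    qed
    obtain s where s: "0 \<le> s" "s \<le> 1" "z = (1 - s) *\<^sub>R a + s *\<^sub>R b" using zs(1) by (auto simp: in_segment)
    obtain t where t: "0 \<le> t" "t \<le> 1" "z = (1 - t) *\<^sub>R c + t *\<^sub>R d" using zs(2) by (auto simp: in_segment)
    have st: "s \<noteq> 0" "s \<noteq> 1" "t \<noteq> 0" "t \<noteq> 1" using s t \<open>z \<notin> e\<close> \<open>z \<notin> f\<close> ab cd by auto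
    have apart: "e \<inter> f = {}"
    proof (rule ccontr)
      assume "e \<inter> f \<noteq> {}"
      then obtain v p q where v: "e = {v, p}" "f = {v, q}" "v \<noteq> p" "v \<noteq> q" "p \<noteq> q"
        using ab cd ef by auto
      have vV: "v \<in> \<Union>E" "p \<in> \<Union>E" "q \<in> \<Union>E" using v V ab(4) cd(4) by (auto simp: doubleton_eq_iff)
      have "z \<in> closed_segment v p" "z \<in> closed_segment v q"
        using z v by (simp_all add: edge_segment_pair)
      then obtain s t where s: "z = (1 - s) *\<^sub>R v + s *\<^sub>R p" and t: "z = (1 - t) *\<^sub>R v + t *\<^sub>R q"
        unfolding in_segment by blast
      have st: "s \<noteq> 0" "t \<noteq> 0" using s t \<open>z \<notin> e\<close> v by auto
      have "z - v = s *\<^sub>R (p - v)" unfolding s by (simp add: algebra_simps)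
      moreover have "z - v = t *\<^sub>R (q - v)" unfolding t by (simp add: algebra_simps)
      ultimately have "cross2 (s *\<^sub>R (p - v)) (t *\<^sub>R (q - v)) = 0" by (metis cross2_def diff_self mult.commute)
      then have "s * t * cross2 (p - v) (q - v) = 0" by (simp add: cross2_def algebra_simps)
      then show False using st in_gen_posD[OF gp vV] v by auto
    qed
    then have dist4: "a \<noteq> c" "a \<noteq> d" "b \<noteq> c" "b \<noteq> d" using ab cd by auto
    have zhull: "z \<in> convex hull (\<Union>E)" using hull[OF e] z by blast
    \<comment> \<open>The sides at \<open>z\<close> are pieces of visibility edges, which segments
      can touch only at their endpoints, and each piece contains just one of these.\<close>
    have free: "unobstructed E p z q"
      if p: "p \<in> e" and q: "q \<in> f" for p q
    proof -
      have "edge_segment g \<inter> (closed_segment p z \<union> closed_segment z q) \<subseteq> {p, q}" if g: "g \<in> E" for g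
      proof
        fix y assume y: "y \<in> edge_segment g \<inter> (closed_segment p z \<union> closed_segment z q)"
        have sub: "closed_segment p z \<subseteq> closed_segment a b" "closed_segment z q \<subseteq> closed_segment c d"
          using p q ab cd zs by (auto simp: subset_closed_segment)
        have ye: "y \<in> e" if "y \<in> closed_segment p z"
          using visible_edgeD[of e g] e g Xv y sub that ab by (auto simp: edge_segment_pair)
        have yf: "y \<in> f" if "y \<in> closed_segment z q"
          using visible_edgeD[of f g] f g Xv y sub that cd by (auto simp: edge_segment_pair)
        have end_only: "w = p" if "w \<in> closed_segment p z" "w \<in> e" for w
        proof (rule ccontr)
          assume "w \<noteq> p"
          then have wp: "e = {w, p}" using that p ab by auto
          then have "z \<in> closed_segment w p" using z by (simp add: edge_segment_pair)
          then have "dist w p = dist w z + dist z p" by (metis between between_mem_segment)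
          moreover have "dist p z = dist p w + dist w z" using that(1) by (metis between between_mem_segment)
          ultimately have "dist w z = 0" using zero_le_dist[of w z] by (simp add: dist_commute)
          then show False using \<open>z \<notin> e\<close> wp by auto
        qed
        have end_only': "w = q" if "w \<in> closed_segment z q" "w \<in> f" for w
        proof (rule ccontr)
          assume "w \<noteq> q"
          then have wp: "f = {w, q}" using that q cd by auto
          then have "z \<in> closed_segment w q" using z by (simp add: edge_segment_pair)
          then have "dist w q = dist w z + dist z q" by (metis between between_mem_segment)
          moreover have "dist z q = dist z w + dist w q" using that(1) by (metis between between_mem_segment)
          ultimately have "dist w z = 0" using zero_le_dist[of w z] by (simp add: dist_commute)
          then show False using \<open>z \<notin> f\<close> wp by auto
        qed
        show "y \<in> {p, q}" using y ye yf end_only end_only' by blast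
      qed
      then show ?thesis unfolding unobstructed_def by blast
    qed
    have nz1: "cross2 (a - z) (c - z) \<noteq> 0"
    proof -
      have "a - z = s *\<^sub>R (a - b)" unfolding s by (simp add: algebra_simps)
      moreover have "cross2 (s *\<^sub>R (a - b)) (c - z) = s * cross2 (b - a) (z - c)"
        by (simp add: cross2_def algebra_simps)
      moreover have "cross2 (b - a) (z - c) = cross2 (b - a) ((1 - s) *\<^sub>R a + s *\<^sub>R b - c)" unfolding s ..
      moreover have "\<dots> = - cross2 (b - a) (c - a)" by (simp add: cross2_def algebra_simps)
      ultimately show ?thesis using st in_gen_posD[OF gp V(1,2,3)] ab dist4 by auto
    qed
    have nz2: "cross2 (b - z) (d - z) \<noteq> 0"
    proof -
      have "b - z = (1 - s) *\<^sub>R (b - a)" unfolding s by (simp add: algebra_simps)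
      moreover have "cross2 ((1 - s) *\<^sub>R (b - a)) (d - z) = (1 - s) * cross2 (b - a) (d - z)"
        by (simp add: cross2_def algebra_simps)
      moreover have "cross2 (b - a) (d - z) = cross2 (b - a) (d - ((1 - s) *\<^sub>R a + s *\<^sub>R b))" unfolding s ..
      moreover have "\<dots> = cross2 (b - a) (d - a)" by (simp add: cross2_def algebra_simps)
      ultimately show ?thesis using st in_gen_posD[OF gp V(1,2,4)] ab dist4 by auto
    qed
    \<comment> \<open>Joining \<open>a\<close> to \<open>c\<close> and \<open>b\<close> to
      \<open>d\<close> has the same boundary as the crossing pair, and the four pieces at
      \<open>z\<close> add up to the two old edges.\<close>
    obtain Z1 where Z1: "Z1 \<subseteq> visible_edges E B" "odd_ends (\<lambda>e. e) Z1 = {a, c}"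
      "total_length Z1 < dist a z + dist z c"
      using blue_shortcut[OF nz1 free ab(1) cd(1) zhull] ab cd by blast
    obtain Z2 where Z2: "Z2 \<subseteq> visible_edges E B" "odd_ends (\<lambda>e. e) Z2 = {b, d}"
      "total_length Z2 < dist b z + dist z d"
      using blue_shortcut[OF nz2 free ab(2) cd(2) zhull] ab cd by blast
    have finZ: "finite Z1" "finite Z2" using Z1 Z2 fin_vis finite_subset by blast+
    have "odd_ends (\<lambda>e. e) (sym_diff Z1 Z2) = sym_diff {a, c} {b, d}"
      using odd_ends_sym_diff[OF finZ, of "\<lambda>e. e"] Z1 Z2 by simp
    moreover have "odd_ends (\<lambda>e. e) (sym_diff {e} {f}) = sym_diff e f"
      using odd_ends_sym_diff[of "{e}" "{f}" "\<lambda>e. e"] by simp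
    moreover have "sym_diff {e} {f} = {e, f}" using ef by auto
    moreover have "sym_diff {a, c} {b, d} = sym_diff e f" using ab cd dist4 by auto
    ultimately have "odd_ends (\<lambda>e. e) (sym_diff Z1 Z2) = odd_ends (\<lambda>e. e) {e, f}" by simp
    then have "total_length {e, f} \<le> total_length (sym_diff Z1 Z2)"
      using e f Z1 Z2 by (intro optimal) auto
    also have "\<dots> \<le> total_length Z1 + total_length Z2" by (rule total_length_sym_diff_le[OF finZ])
    also have "\<dots> < (dist a z + dist z c) + (dist b z + dist z d)" using Z1 Z2 by simp
    also have "\<dots> = dist a b + dist c d"
    proof -
      have "dist a b = dist a z + dist z b" using zs(1) by (metis between between_mem_segment)
      moreover have "dist c d = dist c z + dist z d" using zs(2) by (metis between between_mem_segment)
      ultimately show ?thesis by (simp add: dist_commute)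
    qed
    also have "\<dots> = total_length {e, f}" using ef ab(4) cd(4) by simp
    finally show False by simp
  qed
  have degree_one: "card {e \<in> X. v \<in> e} = 1" if v: "v \<in> B" for v
  proof (rule ccontr)
    assume ne: "card {e \<in> X. v \<in> e} \<noteq> 1"
    have "odd (card {e \<in> X. v \<in> e})" using Xo v unfolding odd_ends_def by blast
    with ne have "card {e \<in> X. v \<in> e} \<ge> 3" by (auto elim!: oddE)
    then obtain D where D: "D \<subseteq> {e \<in> X. v \<in> e}" "card D = 3" by (rule obtain_subset_with_card_n)
    then obtain e1 e2 e3 where e: "D = {e1, e2, e3}" "e1 \<noteq> e2" "e1 \<noteq> e3" "e2 \<noteq> e3"
      using card_3_iff by metis
    have nb: "\<exists>p. p \<in> B \<and> p \<noteq> v \<and> e = {v, p}" if "e \<in> D" for e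
    proof -
      have "e \<in> X" "v \<in> e" using D that by auto
      then show ?thesis using X_edge[of e] by fastforce
    qed
    obtain a where a: "a \<in> B" "a \<noteq> v" "e1 = {v, a}" using nb[of e1] e by auto
    obtain b where b: "b \<in> B" "b \<noteq> v" "e2 = {v, b}" using nb[of e2] e by auto
    obtain c where c: "c \<in> B" "c \<noteq> v" "e3 = {v, c}" using nb[of e3] e by auto
    obtain g where g: "g \<in> E" "v \<in> g" using v B_sub by auto
    obtain h where h: "h \<notin> B" "g = {v, h}" using blue[OF g(1)] g v by auto
    have vV: "v \<in> \<Union>E" and hV: "h \<in> \<Union>E" using g h by auto
    have vh: "v \<noteq> h" using v h by auto
    \<comment> \<open>The sign of \<open>G\<close> tells the side of the line through the segment
      \<open>vh\<close>. An odd degree other than 1 gives three neighbours, two of them on one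
      side.\<close>
    define G where "G = (\<lambda>p. cross2 (h - v) (p - v))"
    have G0: "G p \<noteq> 0" if "p \<in> B" "p \<noteq> v" for p
      using in_gen_posD[OF gp vV hV, of p] that B_sub h vh unfolding G_def by blast
    have same_side: False
      if p: "p \<in> B" "p \<noteq> v" "{v, p} \<in> X" and q: "q \<in> B" "q \<noteq> v" "{v, q} \<in> X"
        and pq: "p \<noteq> q" and side: "G p * G q > 0" for p q
    proof -
      have V: "p \<in> \<Union>E" "q \<in> \<Union>E" using p q B_sub by auto
      have nz: "cross2 (p - v) (q - v) \<noteq> 0" using in_gen_posD[OF gp vV V] p q pq by auto
      \<comment> \<open>Outside \<open>p\<close> and \<open>q\<close> only the segment
        \<open>g\<close> at \<open>v\<close> can meet the two sides. It lies on the line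
        \<open>G = 0\<close>, while \<open>G\<close> has no zero in the open triangle.\<close>
      have un: "unobstructed E p v q"
        unfolding unobstructed_def
      proof (intro ballI impI subsetI, rule ccontr)
        fix f y assume f: "f \<in> E" "edge_segment f \<inter> open_triangle p v q \<noteq> {}"
          and y: "y \<in> edge_segment f \<inter> (closed_segment p v \<union> closed_segment v q)" and yn: "y \<notin> {p, q}"
        have "y \<in> {p, v} \<union> {v, q}"
          using visible_edgeD[of "{v, p}" f] visible_edgeD[of "{v, q}" f] p(3) q(3) Xv f(1) y
          by (auto simp: edge_segment_pair closed_segment_commute)
        then have "y = v" using yn by auto
        then have "f = g" using endpoint_unique[OF g(1) f(1) g(2)] y by auto
        then obtain z where z: "z \<in> closed_segment v h" "z \<in> open_triangle p v q"
          using f(2) h by (auto simp: edge_segment_pair)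
        obtain w where w: "z = (1 - w) *\<^sub>R v + w *\<^sub>R h" using z(1) by (auto simp: in_segment)
        obtain s t where st: "0 < s" "0 < t" "z = v + s *\<^sub>R (p - v) + t *\<^sub>R (q - v)"
          using z(2) by (auto simp: open_triangle_def)
        have "G z = 0" unfolding G_def w by (simp add: cross2_def algebra_simps)
        moreover have "G z = s * G p + t * G q" unfolding G_def st by (simp add: cross2_def algebra_simps)
        ultimately have "s * G p + t * G q = 0" by simp
        then have "(s * G p + t * G q) * G p = 0" by simp
        then have "s * (G p * G p) + t * (G p * G q) = 0" by (simp add: algebra_simps)
        moreover have "s * (G p * G p) > 0" using st G0[OF p(1,2)] by (metis mult_pos_pos not_real_square_gt_zero)
        moreover have "t * (G p * G q) > 0" using st side by simp
        ultimately show False by linarith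
      qed
      have vh: "v \<in> convex hull (\<Union>E)" using vV by (rule hull_inc)
      obtain Z where Z: "Z \<subseteq> visible_edges E B" "odd_ends (\<lambda>e. e) Z = {p, q}"
        "total_length Z < dist p v + dist v q"
        using blue_shortcut[OF nz un p(1) q(1) vh] by blast
      have ne: "{v, p} \<noteq> {v, q}" using pq by (auto simp: doubleton_eq_iff)
      then have "sym_diff {{v, p}} {{v, q}} = {{v, p}, {v, q}}" by auto
      then have "odd_ends (\<lambda>e. e) {{v, p}, {v, q}} = sym_diff {v, p} {v, q}"
        using odd_ends_sym_diff[of "{{v, p}}" "{{v, q}}" "\<lambda>e. e"] by simp
      also have "\<dots> = {p, q}" using p q pq by auto
      finally have "total_length {{v, p}, {v, q}} \<le> total_length Z"
        using p q Z by (intro optimal) auto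
      moreover have "total_length {{v, p}, {v, q}} = dist p v + dist v q" using ne by (simp add: dist_commute)
      ultimately show False using Z by simp
    qed
    have "a \<noteq> b" "a \<noteq> c" "b \<noteq> c" using e a b c by auto
    moreover have "e1 \<in> X" "e2 \<in> X" "e3 \<in> X" using D e by auto
    moreover have "G a * G b > 0 \<or> G a * G c > 0 \<or> G b * G c > 0"
      using G0[OF a(1,2)] G0[OF b(1,2)] G0[OF c(1,2)]
      by (metis linorder_neqE_linordered_idom mult_neg_neg mult_pos_pos)
    ultimately show False using same_side a b c by metis
  qed
  show ?thesis using that Xv noncross degree_one by blast
qed

end

section \<open>Vertices and edges of the convex hull\<close>

text \<open>Extremality by a strict functional passes to subsets at once, which the induction over
  chords needs.\<close>

definition hull_vertex :: "point set \<Rightarrow> point \<Rightarrow> bool" where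
  "hull_vertex V p \<longleftrightarrow> p \<in> V \<and> (\<exists>l. \<forall>v\<in>V - {p}. l \<bullet> v < l \<bullet> p)"

definition hull_edge :: "point set \<Rightarrow> point \<Rightarrow> point \<Rightarrow> bool" where
  "hull_edge V p q \<longleftrightarrow>
     p \<in> V \<and> q \<in> V \<and> p \<noteq> q \<and> (\<exists>l. l \<bullet> p = l \<bullet> q \<and> (\<forall>v\<in>V - {p, q}. l \<bullet> v < l \<bullet> p))"

lemma hull_vertex_subset: "hull_vertex V p \<Longrightarrow> W \<subseteq> V \<Longrightarrow> p \<in> W \<Longrightarrow> hull_vertex W p"
  unfolding hull_vertex_def by (meson Diff_mono in_mono order_refl)

lemma hull_edge_sym: "hull_edge V p q \<Longrightarrow> hull_edge V q p"
  unfolding hull_edge_def by (metis insert_commute)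

lemma inner2: "(u::point) \<bullet> v = u $ 1 * v $ 1 + u $ 2 * v $ 2"
  by (simp add: inner_vec_def sum_2)

text \<open>A possible tie at \<open>q\<close> is broken by tilting the functional in the direction
  \<open>p - q\<close>; a large multiple of \<open>l\<close> preserves the strict inequalities at
  the other points.\<close>

lemma hull_vertex_perturb:
  assumes fin: "finite V" and p: "p \<in> V"
    and le: "\<And>v. v \<in> V \<Longrightarrow> v \<noteq> p \<Longrightarrow> v \<noteq> q \<Longrightarrow> l \<bullet> v < l \<bullet> p" and q: "l \<bullet> q \<le> l \<bullet> p"
  shows "hull_vertex V p"
proof -
  \<comment> \<open>The sum dominates each ratio of tilt to gap, so \<open>N\<close> works for all
    \<open>v\<close> at once. A vanishing gap, as at \<open>v = p\<close>, contributes 0 because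
    division by 0 yields 0.\<close>
  define N where "N = 1 + (\<Sum>v\<in>V. \<bar>(p - q) \<bullet> (p - v)\<bar> / \<bar>l \<bullet> (p - v)\<bar>)"
  have N0: "N > 0" unfolding N_def by (intro add_pos_nonneg sum_nonneg) auto
  have "(N *\<^sub>R l + (p - q)) \<bullet> v < (N *\<^sub>R l + (p - q)) \<bullet> p" if v: "v \<in> V - {p}" for v
  proof -
    have "N * (l \<bullet> (p - v)) + (p - q) \<bullet> (p - v) > 0"
    proof (cases "v = q")
      case True
      then have "(p - q) \<bullet> (p - v) > 0" using v by auto
      moreover have "N * (l \<bullet> (p - v)) \<ge> 0" using N0 q True by (simp add: inner_diff_right)
      ultimately show ?thesis by simp
    next
      case False
      then have d: "l \<bullet> (p - v) > 0" using le v by (simp add: inner_diff_right)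
      have "\<bar>(p - q) \<bullet> (p - v)\<bar> / \<bar>l \<bullet> (p - v)\<bar> \<le> (\<Sum>v\<in>V. \<bar>(p - q) \<bullet> (p - v)\<bar> / \<bar>l \<bullet> (p - v)\<bar>)"
        using v fin by (intro member_le_sum) auto
      then have "1 + \<bar>(p - q) \<bullet> (p - v)\<bar> / (l \<bullet> (p - v)) \<le> N" using d by (simp add: N_def)
      then have "(1 + \<bar>(p - q) \<bullet> (p - v)\<bar> / (l \<bullet> (p - v))) * (l \<bullet> (p - v)) \<le> N * (l \<bullet> (p - v))"
        using d by (intro mult_right_mono) auto
      then have "l \<bullet> (p - v) + \<bar>(p - q) \<bullet> (p - v)\<bar> \<le> N * (l \<bullet> (p - v))" using d by (simp add: distrib_right)
      then show ?thesis using d by linarith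
    qed
    then show ?thesis by (simp add: inner_diff_right inner_add_left algebra_simps)
  qed
  then show ?thesis using p unfolding hull_vertex_def by blast
qed

lemma hull_edge_vertices:
  assumes "finite V" "hull_edge V p q"
  shows "hull_vertex V p" "hull_vertex V q"
proof -
  have *: "hull_vertex V p" if e: "hull_edge V p q" for p q
  proof -
    obtain l where l: "p \<in> V" "l \<bullet> p = l \<bullet> q" "\<forall>v\<in>V - {p, q}. l \<bullet> v < l \<bullet> p"
      using e unfolding hull_edge_def by blast
    show ?thesis by (rule hull_vertex_perturb[OF assms(1) l(1), of q l]) (use l in auto)
  qed
  show "hull_vertex V p" "hull_vertex V q" using * assms hull_edge_sym by blast+
qed

text \<open>In the plane the vectors orthogonal to a nonzero vector form a line.\<close>

lemma orthogonal_cross2: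
  assumes "l \<noteq> 0" "l \<bullet> u = 0" "l \<bullet> w = 0"
  shows "cross2 u w = 0"
proof -
  have u: "l $ 1 * u $ 1 + l $ 2 * u $ 2 = 0" and w: "l $ 1 * w $ 1 + l $ 2 * w $ 2 = 0"
    using assms by (simp_all add: inner2)
  have "l $ 1 * cross2 u w = (l $ 1 * u $ 1 + l $ 2 * u $ 2) * w $ 2 - (l $ 1 * w $ 1 + l $ 2 * w $ 2) * u $ 2"
    by (simp add: cross2_def algebra_simps)
  moreover have "l $ 2 * cross2 u w = (l $ 1 * w $ 1 + l $ 2 * w $ 2) * u $ 1 - (l $ 1 * u $ 1 + l $ 2 * u $ 2) * w $ 1"
    by (simp add: cross2_def algebra_simps)
  ultimately have "l $ 1 * cross2 u w = 0" "l $ 2 * cross2 u w = 0" unfolding u w by simp_all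
  moreover have "l $ 1 \<noteq> 0 \<or> l $ 2 \<noteq> 0" using assms(1) by (simp add: vec2_eq_iff)
  ultimately show ?thesis by auto
qed

text \<open>Separating \<open>x\<close> from the interior gives the support; a convex set without
  interior lies in a hyperplane, which supports it trivially.\<close>

lemma frontier_support:
  fixes S :: "'a::euclidean_space set"
  assumes "convex S" "x \<in> S" "x \<notin> interior S"
  obtains a where "a \<noteq> 0" "\<And>y. y \<in> S \<Longrightarrow> a \<bullet> y \<le> a \<bullet> x"
proof (cases "interior S = {}")
  case True
  then obtain a b where "a \<noteq> 0" "S \<subseteq> {y. a \<bullet> y = b}"
    using empty_interior_subset_hyperplane[OF assms(1)] by metis
  then have "a \<bullet> y \<le> a \<bullet> x" if "y \<in> S" for y
    using assms(2) that by (metis (mono_tags) mem_Collect_eq order_refl subsetD)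
  then show ?thesis using that \<open>a \<noteq> 0\<close> by blast
next
  case False
  obtain a b where ab: "a \<noteq> 0" "\<forall>y\<in>interior S. a \<bullet> y \<le> b" "\<forall>y\<in>{x}. a \<bullet> y \<ge> b"
    using separating_hyperplane_sets[of "interior S" "{x}"] assms False by auto
  have "closure (interior S) \<subseteq> {y. a \<bullet> y \<le> b}"
    using ab by (intro closure_minimal closed_halfspace_le) auto
  then have "S \<subseteq> {y. a \<bullet> y \<le> b}"
    using convex_closure_interior[OF assms(1) False] closure_subset by blast
  then show ?thesis using ab that[of a] by force
qed

text \<open>By general position the supporting line at \<open>p\<close> carries at most one further
  vertex, and \<open>hull_vertex_perturb\<close> breaks that tie.\<close>

lemma frontier_hull_vertex:
  assumes fin: "finite V" and gp: "in_gen_pos V" and p: "p \<in> V"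
    and fr: "p \<in> frontier (convex hull V)"
  shows "hull_vertex V p"
proof -
  have "p \<notin> interior (convex hull V)" using fr by (simp add: frontier_def)
  then obtain l where l: "l \<noteq> 0" "\<And>y. y \<in> convex hull V \<Longrightarrow> l \<bullet> y \<le> l \<bullet> p"
    by (rule frontier_support[OF convex_convex_hull hull_inc[OF p]]) blast
  have le: "l \<bullet> v \<le> l \<bullet> p" if "v \<in> V" for v using l that by (simp add: hull_inc)
  show ?thesis
  proof (cases "\<exists>q\<in>V. q \<noteq> p \<and> l \<bullet> q = l \<bullet> p")
    case True
    then obtain q where q: "q \<in> V" "q \<noteq> p" "l \<bullet> q = l \<bullet> p" by blast
    show ?thesis
    proof (rule hull_vertex_perturb[OF fin p, of q l])
      fix v assume v: "v \<in> V" "v \<noteq> p" "v \<noteq> q"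
      have "l \<bullet> v \<noteq> l \<bullet> p"
      proof
        assume "l \<bullet> v = l \<bullet> p"
        then have "cross2 (q - p) (v - p) = 0"
          using q by (intro orthogonal_cross2[OF l(1)]) (simp_all add: inner_diff_right)
        then show False using in_gen_posD[OF gp p q(1) v(1)] q v by auto
      qed
      then show "l \<bullet> v < l \<bullet> p" using le v by force
    qed (use q in simp)
  next
    case False
    then show ?thesis using le p unfolding hull_vertex_def by (metis Diff_iff insertCI less_eq_real_def)
  qed
qed

lemma hull_vertex_max:
  assumes "\<forall>v\<in>V - {p}. l \<bullet> v < l \<bullet> p" "y \<in> convex hull V"
  shows "l \<bullet> y \<le> l \<bullet> p"
proof -
  have "convex hull V \<subseteq> {y. l \<bullet> y \<le> l \<bullet> p}"
    using assms(1) by (intro hull_minimal) (auto simp: convex_halfspace_le intro: less_imp_le)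
  then show ?thesis using assms(2) by blast
qed

text \<open>Otherwise \<open>p\<close> is a convex combination with positive weight on both
  \<open>a\<close> and \<open>b\<close>, one of which differs from \<open>p\<close>, against strict
  maximality. This is the source of \<open>inner_blue\<close>.\<close>

lemma hull_vertex_not_in_triangle:
  assumes p: "hull_vertex V p" and a: "a \<in> V" and b: "b \<in> V" and ab: "a \<noteq> b"
    and x: "x \<in> convex hull V"
  shows "p \<notin> open_triangle a x b"
proof
  assume "p \<in> open_triangle a x b"
  then obtain s t where st: "0 < s" "0 < t" "s + t < 1" and eq: "p = x + s *\<^sub>R (a - x) + t *\<^sub>R (b - x)"
    by (auto simp: open_triangle_def)
  obtain l where l: "\<forall>v\<in>V - {p}. l \<bullet> v < l \<bullet> p" using p unfolding hull_vertex_def by blast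
  have "l \<bullet> p = l \<bullet> x + s * (l \<bullet> a - l \<bullet> x) + t * (l \<bullet> b - l \<bullet> x)"
    by (subst eq) (simp add: inner_add_right inner_diff_right)
  then have sum0: "(1 - s - t) * (l \<bullet> p - l \<bullet> x) + s * (l \<bullet> p - l \<bullet> a) + t * (l \<bullet> p - l \<bullet> b) = 0"
    by (simp add: algebra_simps)
  have "l \<bullet> x \<le> l \<bullet> p" "l \<bullet> a \<le> l \<bullet> p" "l \<bullet> b \<le> l \<bullet> p"
    using hull_vertex_max[OF l] x a b by (auto simp: hull_inc)
  then have nonneg: "(1 - s - t) * (l \<bullet> p - l \<bullet> x) \<ge> 0" "s * (l \<bullet> p - l \<bullet> a) \<ge> 0" "t * (l \<bullet> p - l \<bullet> b) \<ge> 0"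
    using st by auto
  consider "a \<noteq> p" | "b \<noteq> p" using ab by auto
  then show False
  proof cases
    case 1
    then have "s * (l \<bullet> p - l \<bullet> a) > 0" using l a st by auto
    then show False using sum0 nonneg by linarith
  next
    case 2
    then have "t * (l \<bullet> p - l \<bullet> b) > 0" using l b st by auto
    then show False using sum0 nonneg by linarith
  qed
qed

text \<open>A common point maximises the functional of \<open>hk\<close>, so each endpoint of
  \<open>pq\<close> with positive weight in it is \<open>h\<close> or \<open>k\<close>. As the pairs
  differ, only one endpoint carries weight.\<close>

lemma hull_edge_noncrossing:
  assumes he: "hull_edge V h k" and p: "p \<in> V" and q: "q \<in> V" and ne: "{p, q} \<noteq> {h, k}" and pq: "p \<noteq> q"
  shows "closed_segment h k \<inter> closed_segment p q \<subseteq> {h, k} \<inter> {p, q}"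
proof
  fix z assume z: "z \<in> closed_segment h k \<inter> closed_segment p q"
  obtain l where l: "l \<bullet> h = l \<bullet> k" "\<forall>v\<in>V - {h, k}. l \<bullet> v < l \<bullet> h"
    using he unfolding hull_edge_def by blast
  have le: "l \<bullet> v \<le> l \<bullet> h" if "v \<in> V" for v using l that by (cases "v \<in> {h, k}") (auto intro: less_imp_le)
  have eq: "v \<in> {h, k}" if "v \<in> V" "l \<bullet> v = l \<bullet> h" for v
    using l(2) that by (metis DiffI less_irrefl)
  obtain s where s: "z = (1 - s) *\<^sub>R h + s *\<^sub>R k" using z by (auto simp: in_segment)
  have lz: "l \<bullet> z = l \<bullet> h" unfolding s using l(1) by (simp add: inner_add_right algebra_simps)
  obtain t where t: "0 \<le> t" "t \<le> 1" "z = (1 - t) *\<^sub>R p + t *\<^sub>R q" using z by (auto simp: in_segment)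
  have "(1 - t) * (l \<bullet> h - l \<bullet> p) + t * (l \<bullet> h - l \<bullet> q) = 0"
    using lz unfolding t(3) by (simp add: inner_add_right algebra_simps)
  moreover have "(1 - t) * (l \<bullet> h - l \<bullet> p) \<ge> 0" "t * (l \<bullet> h - l \<bullet> q) \<ge> 0" using t le p q by auto
  ultimately have "(1 - t) * (l \<bullet> h - l \<bullet> p) = 0" "t * (l \<bullet> h - l \<bullet> q) = 0" by linarith+
  then have "t = 1 \<or> l \<bullet> p = l \<bullet> h" "t = 0 \<or> l \<bullet> q = l \<bullet> h" unfolding mult_eq_0_iff by linarith+
  then have "t = 1 \<or> p \<in> {h, k}" "t = 0 \<or> q \<in> {h, k}" using eq p q by blast+
  then have "(t = 1 \<and> q \<in> {h, k}) \<or> (t = 0 \<and> p \<in> {h, k})" using ne pq by auto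
  then show "z \<in> {h, k} \<inter> {p, q}" using t(3) by auto
qed

section \<open>Neighbours on the hull boundary\<close>

lemma cross2_inner_identity:
  "(l \<bullet> l) * cross2 u w = (l \<bullet> u) * cross2 l w - (l \<bullet> w) * cross2 l u"
  by (simp add: inner2 cross2_def algebra_simps)

text \<open>The quarter turn; it makes a determinant with fixed first argument an inner product, as
  \<open>hull_edge\<close> requires.\<close>

definition rot :: "point \<Rightarrow> point" where
  "rot w = vector [- w $ 2, w $ 1]"

lemma inner_rot: "rot w \<bullet> v = cross2 w v"
  by (simp add: rot_def inner2 cross2_def)

text \<open>Seen from \<open>h\<close>, all other vertices lie in an open half-plane and are ordered
  by direction. The two extreme ones give hull edges and enclose the rest in a cone, which takes the
  place of a cyclic order in what follows.\<close>

lemma hull_neighbours: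
  assumes fin: "finite V" and gp: "in_gen_pos V" and h: "hull_vertex V h" and c3: "card V \<ge> 3"
  obtains k1 k2 where "k1 \<noteq> k2" "hull_edge V h k1" "hull_edge V h k2"
    "\<And>v. v \<in> V \<Longrightarrow> \<exists>s\<ge>0. \<exists>t\<ge>0. v - h = s *\<^sub>R (k1 - h) + t *\<^sub>R (k2 - h)"
proof -
  obtain l where hV: "h \<in> V" and l: "\<forall>v\<in>V - {h}. l \<bullet> v < l \<bullet> h" using h unfolding hull_vertex_def by blast
  \<comment> \<open>The tangent of the signed angle between \<open>v - h\<close> and
    \<open>- l\<close>.\<close>
  define slope where "slope = (\<lambda>v. cross2 l (v - h) / (l \<bullet> (h - v)))"
  let ?W = "V - {h}"
  have W: "finite ?W" "card ?W \<ge> 2" using fin c3 hV by auto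
  then have Wne: "?W \<noteq> {}" by (metis card.empty not_numeral_le_zero)
  have ord: "cross2 (v - h) (w - h) > 0" if v: "v \<in> ?W" and w: "w \<in> ?W" and vw: "v \<noteq> w" and s: "slope w \<le> slope v" for v w
  proof -
    have n: "l \<bullet> (h - v) > 0" "l \<bullet> (h - w) > 0" using l v w by (auto simp: inner_diff_right)
    then have "cross2 l (w - h) * (l \<bullet> (h - v)) \<le> cross2 l (v - h) * (l \<bullet> (h - w))"
      using s unfolding slope_def by (simp add: divide_simps mult.commute)
    moreover have "(l \<bullet> l) * cross2 (v - h) (w - h) = (l \<bullet> (h - w)) * cross2 l (v - h) - (l \<bullet> (h - v)) * cross2 l (w - h)"
      unfolding cross2_inner_identity by (simp add: inner_diff_right algebra_simps)
    ultimately have "(l \<bullet> l) * cross2 (v - h) (w - h) \<ge> 0" by (simp add: mult.commute)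
    moreover have "l \<bullet> l > 0" using n by (metis inner_eq_zero_iff inner_gt_zero_iff inner_zero_left less_irrefl)
    ultimately have "cross2 (v - h) (w - h) \<ge> 0" by (simp add: zero_le_mult_iff)
    moreover have "cross2 (v - h) (w - h) \<noteq> 0" using in_gen_posD[OF gp hV] v w vw by auto
    ultimately show ?thesis by simp
  qed
  obtain k1 where k1: "k1 \<in> ?W" "\<And>v. v \<in> ?W \<Longrightarrow> slope k1 \<le> slope v"
    using W Wne by (metis (no_types, lifting) arg_min_if_finite(1) arg_min_least)
  obtain k2 where k2: "k2 \<in> ?W" "\<And>v. v \<in> ?W \<Longrightarrow> slope v \<le> slope k2"
  proof -
    have "Max (slope ` ?W) \<in> slope ` ?W" using W(1) Wne by (intro Max_in) auto
    then obtain k where "k \<in> ?W" "slope k = Max (slope ` ?W)" by force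
    then show ?thesis using that[of k] W(1) by simp
  qed
  obtain w where w: "w \<in> ?W" "w \<noteq> k1"
  proof -
    have "\<not> ?W \<subseteq> {k1}" using W(2) card_mono[of "{k1}" ?W] by auto
    then show ?thesis using that by blast
  qed
  have ne: "k1 \<noteq> k2"
  proof
    assume eq: "k1 = k2"
    have "cross2 (w - h) (k1 - h) > 0" "cross2 (k1 - h) (w - h) > 0"
      using ord k1 k2 w eq by auto
    then show False by (simp add: cross2_def algebra_simps)
  qed
  have e1: "hull_edge V h k1"
    unfolding hull_edge_def
  proof (intro conjI exI[of _ "rot (k1 - h)"] ballI)
    show "rot (k1 - h) \<bullet> h = rot (k1 - h) \<bullet> k1" by (simp add: inner_rot cross2_def algebra_simps)
    fix v assume v: "v \<in> V - {h, k1}"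
    then have "cross2 (v - h) (k1 - h) > 0" using ord k1 by auto
    then show "rot (k1 - h) \<bullet> v < rot (k1 - h) \<bullet> h" by (simp add: inner_rot cross2_def algebra_simps)
  qed (use hV k1 in auto)
  have e2: "hull_edge V h k2"
    unfolding hull_edge_def
  proof (intro conjI exI[of _ "- rot (k2 - h)"] ballI)
    show "- rot (k2 - h) \<bullet> h = - rot (k2 - h) \<bullet> k2" by (simp add: inner_rot cross2_def algebra_simps)
    fix v assume v: "v \<in> V - {h, k2}"
    then have "cross2 (k2 - h) (v - h) > 0" using ord k2 by auto
    then show "- rot (k2 - h) \<bullet> v < - rot (k2 - h) \<bullet> h" by (simp add: inner_rot cross2_def algebra_simps)
  qed (use hV k2 in auto)
  have D: "cross2 (k2 - h) (k1 - h) > 0" using ord k1 k2 ne by auto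
  have "\<exists>s\<ge>0. \<exists>t\<ge>0. v - h = s *\<^sub>R (k1 - h) + t *\<^sub>R (k2 - h)" if v: "v \<in> V" for v
  proof -
    have "cross2 (v - h) (k1 - h) \<ge> 0"
      using ord[of v k1] v k1 by (cases "v = h \<or> v = k1") (auto simp: cross2_def intro: less_imp_le)
    moreover have "cross2 (k2 - h) (v - h) \<ge> 0"
      using ord[of k2 v] v k2 by (cases "v = h \<or> v = k2") (auto simp: cross2_def intro: less_imp_le)
    moreover have "v - h = (cross2 (k2 - h) (v - h) / cross2 (k2 - h) (k1 - h)) *\<^sub>R (k1 - h) +
        (cross2 (v - h) (k1 - h) / cross2 (k2 - h) (k1 - h)) *\<^sub>R (k2 - h)"
      using cross2_coords[of "k2 - h" "k1 - h" "v - h"] D by (simp add: add.commute)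
    ultimately show ?thesis using D by (metis divide_nonneg_pos)
  qed
  then show ?thesis using that ne e1 e2 by blast
qed

text \<open>For any other \<open>k\<close> the functional of \<open>hk\<close> is negative on both
  directions spanning the cone, yet it vanishes on \<open>k - h\<close>, which lies in the
  cone.\<close>

lemma hull_neighbour_unique:
  assumes cone: "\<And>v. v \<in> V \<Longrightarrow> \<exists>s\<ge>0. \<exists>t\<ge>0. v - h = s *\<^sub>R (k1 - h) + t *\<^sub>R (k2 - h)"
    and e: "k1 \<in> V" "k2 \<in> V" "k1 \<noteq> h" "k2 \<noteq> h" and k: "hull_edge V h k"
  shows "k = k1 \<or> k = k2"
proof (rule ccontr)
  assume n: "\<not> (k = k1 \<or> k = k2)"
  obtain l where kV: "k \<in> V" "h \<noteq> k" and l: "l \<bullet> h = l \<bullet> k" "\<forall>v\<in>V - {h, k}. l \<bullet> v < l \<bullet> h"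
    using k unfolding hull_edge_def by blast
  obtain s t where st: "s \<ge> 0" "t \<ge> 0" "k - h = s *\<^sub>R (k1 - h) + t *\<^sub>R (k2 - h)" using cone[OF kV(1)] by blast
  have neg: "l \<bullet> (h - k1) > 0" "l \<bullet> (h - k2) > 0" using l e n by (auto simp: inner_diff_right)
  have "l \<bullet> (k - h) = 0" using l by (simp add: inner_diff_right)
  then have "s * (l \<bullet> (h - k1)) + t * (l \<bullet> (h - k2)) = 0"
    unfolding st(3) by (simp add: inner_diff_right inner_add_right algebra_simps)
  then have "s * (l \<bullet> (h - k1)) = 0" "t * (l \<bullet> (h - k2)) = 0"
    using st neg by (smt (verit) mult_nonneg_nonneg)+
  then have "s = 0" "t = 0" using neg by auto
  then show False using st kV by simp
qed

text \<open>A step of the simplex method: if neither neighbour were higher than \<open>h\<close>,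
  nothing in the cone would be.\<close>

lemma hull_neighbour_ascend:
  assumes fin: "finite V" and gp: "in_gen_pos V" and h: "hull_vertex V h" and c3: "card V \<ge> 3"
    and v: "v \<in> V" "l \<bullet> h < l \<bullet> v"
  obtains k where "hull_edge V h k" "l \<bullet> h < l \<bullet> k"
proof -
  obtain k1 k2 where k: "hull_edge V h k1" "hull_edge V h k2"
    and cone: "\<And>v. v \<in> V \<Longrightarrow> \<exists>s\<ge>0. \<exists>t\<ge>0. v - h = s *\<^sub>R (k1 - h) + t *\<^sub>R (k2 - h)"
    using hull_neighbours[OF fin gp h c3] by metis
  obtain s t where st: "s \<ge> 0" "t \<ge> 0" "v - h = s *\<^sub>R (k1 - h) + t *\<^sub>R (k2 - h)" using cone[OF v(1)] by blast
  have "l \<bullet> (v - h) > 0" using v by (simp add: inner_diff_right)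
  then have "s * (l \<bullet> (k1 - h)) + t * (l \<bullet> (k2 - h)) > 0" unfolding st(3) by (simp add: inner_add_right)
  then have "l \<bullet> (k1 - h) > 0 \<or> l \<bullet> (k2 - h) > 0"
    using st by (smt (verit) mult_nonneg_nonpos)
  then show ?thesis using k that by (auto simp: inner_diff_right)
qed

section \<open>Matching along the convex hull\<close>

text \<open>The detour \<open>q h k q'\<close> is pulled tight in two stages. Cutting the corner at
  \<open>h\<close> yields a path whose last edge \<open>rk\<close> is not admissible,
  \<open>k\<close> being red; it becomes a side of the triangle \<open>r k q'\<close> of the second
  stage. This is why \<open>shortcut\<close> keeps its last edge apart.\<close>

lemma (in blue_points) path_along_hull_edge:
  assumes he: "hull_edge (\<Union>E) h k" and hk: "{h, k} \<notin> E"
    and hq: "{h, q} \<in> E" and kq: "{k, q'} \<in> E" and q: "q \<in> B" and q': "q' \<in> B"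
    and hB: "h \<notin> B" and kB: "k \<notin> B"
  obtains Y where "Y \<subseteq> visible_edges E B" "odd_ends (\<lambda>e. e) Y = {q, q'}"
proof -
  have V: "h \<in> \<Union>E" "k \<in> \<Union>E" "q \<in> \<Union>E" "q' \<in> \<Union>E" using hq kq by auto
  have hk_ne: "h \<noteq> k" using he by (simp add: hull_edge_def)
  have ne: "q \<noteq> h" "q' \<noteq> k" "q \<noteq> k" "q' \<noteq> h" using q q' hB kB by auto
  have "{h, q} \<noteq> {k, q'}" using hk_ne ne by (auto simp: doubleton_eq_iff)
  have qq': "q \<noteq> q'"
  proof
    assume "q = q'"
    then have "{h, q} = {k, q'}"
      using endpoint_unique[OF hq kq, of q] unfolding edge_segment_pair by auto
    then show False using \<open>{h, q} \<noteq> {k, q'}\<close> by simp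
  qed
  have nz: "cross2 (q - h) (k - h) \<noteq> 0" using in_gen_posD[OF gp V(1,3,2)] ne hk_ne by auto
  \<comment> \<open>A segment entering the triangle is not \<open>hq\<close>, hence disjoint from
    it, and on the hull edge \<open>hk\<close> it can touch only \<open>k\<close>.\<close>
  have un: "unobstructed E q h k"
    unfolding unobstructed_def
  proof (intro ballI impI subsetI)
    fix e y assume e: "e \<in> E" "edge_segment e \<inter> open_triangle q h k \<noteq> {}"
      and y: "y \<in> edge_segment e \<inter> (closed_segment q h \<union> closed_segment h k)"
    have e1: "e \<noteq> {h, q}"
    proof
      assume "e = {h, q}"
      then obtain z where z: "z \<in> closed_segment h q" "z \<in> open_triangle q h k"
        using e(2) by (auto simp: edge_segment_pair)
      obtain w where w: "z = (1 - w) *\<^sub>R h + w *\<^sub>R q" using z(1) by (auto simp: in_segment)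
      obtain s t where st: "0 < t" "z = h + s *\<^sub>R (q - h) + t *\<^sub>R (k - h)"
        using z(2) by (auto simp: open_triangle_def)
      have "cross2 (q - h) (z - h) = 0" unfolding w by (simp add: cross2_def algebra_simps)
      moreover have "cross2 (q - h) (z - h) = t * cross2 (q - h) (k - h)"
        unfolding st(2) by (simp add: cross2_def algebra_simps)
      ultimately show False using nz st by simp
    qed
    then have "edge_segment e \<inter> closed_segment h q = {}"
      using disj[OF e(1) hq] by (simp add: edge_segment_pair)
    then have y1: "y \<in> closed_segment h k" and h: "h \<notin> edge_segment e" using y by (auto simp: closed_segment_commute)
    obtain a b where ab: "a \<noteq> b" "e = {a, b}" using pairs[OF e(1)] by blast
    have "{a, b} \<noteq> {h, k}" using e(1) ab hk by auto
    then have "closed_segment h k \<inter> closed_segment a b \<subseteq> {h, k}"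
      using hull_edge_noncrossing[OF he, of a b] ab e(1) by auto
    then have "y \<in> {h, k}" using y1 y ab by (auto simp: edge_segment_pair)
    then show "y \<in> {q, k}" using y h by auto
  qed
  obtain r Y where r: "r \<in> insert q (\<Union>E \<inter> open_triangle q h k)" "sees E r k"
    and Y: "Y \<subseteq> visible_edges E (insert q (\<Union>E \<inter> open_triangle q h k))"
      "odd_ends (\<lambda>e. e) Y = sym_diff {q} {r}"
    using shortcut[OF gp pairs finite_V nz un V(3,2)] by blast
  have hhull: "h \<in> convex hull (\<Union>E)" using V(1) by (rule hull_inc)
  have sub: "insert q (\<Union>E \<inter> open_triangle q h k) \<subseteq> B"
    using q inner_blue[OF V(3,2) ne(3) hhull] by simp
  have Y': "Y \<subseteq> visible_edges E B" using Y(1) visible_edges_mono[OF sub] by blast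
  have finY: "finite Y" using Y' finite_visible_edges[OF finite_B] finite_subset by blast
  have rB: "r \<in> B" using r sub by blast
  have rV: "r \<in> \<Union>E" using rB B_sub by blast
  show ?thesis
  proof (cases "r = q'")
    \<comment> \<open>The first stage has already reached the partner of \<open>k\<close>, and its
      last edge is the segment \<open>k q'\<close>.\<close>
    case True
    then have "odd_ends (\<lambda>e. e) Y = {q, q'}" using Y(2) qq' by auto
    then show ?thesis using that Y' by blast
  next
    case False
    have rk: "r \<noteq> k" using rB kB by auto
    have nz2: "cross2 (r - k) (q' - k) \<noteq> 0" using in_gen_posD[OF gp V(2) rV V(4)] rk ne False by auto
    have un2: "unobstructed E r k q'"
      unfolding unobstructed_def
    proof (intro ballI impI subsetI)
      fix e y assume e: "e \<in> E" "edge_segment e \<inter> open_triangle r k q' \<noteq> {}"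
        and y: "y \<in> edge_segment e \<inter> (closed_segment r k \<union> closed_segment k q')"
      have e1: "e \<noteq> {k, q'}"
      proof
        assume "e = {k, q'}"
        then obtain z where z: "z \<in> closed_segment k q'" "z \<in> open_triangle r k q'"
          using e(2) by (auto simp: edge_segment_pair)
        obtain w where w: "z = (1 - w) *\<^sub>R k + w *\<^sub>R q'" using z(1) by (auto simp: in_segment)
        obtain s t where st: "0 < s" "z = k + s *\<^sub>R (r - k) + t *\<^sub>R (q' - k)"
          using z(2) by (auto simp: open_triangle_def)
        have "cross2 (z - k) (q' - k) = 0" unfolding w by (simp add: cross2_def algebra_simps)
        moreover have "cross2 (z - k) (q' - k) = s * cross2 (r - k) (q' - k)"
          unfolding st(2) by (simp add: cross2_def algebra_simps)
        ultimately show False using nz2 st by simp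
      qed
      then have d: "edge_segment e \<inter> closed_segment k q' = {}"
        using disj[OF e(1) kq] by (simp add: edge_segment_pair)
      then have y1: "y \<in> closed_segment r k" and k: "k \<notin> edge_segment e" using y by auto
      have "k \<notin> e" using k by (metis edge_segment_def hull_inc)
      then have "e \<noteq> {r, k}" by auto
      then have "y \<in> {r, k}" using r(2) e(1) y y1 unfolding sees_def by blast
      then show "y \<in> {r, q'}" using y k by auto
    qed
    have khull: "k \<in> convex hull (\<Union>E)" using V(2) by (rule hull_inc)
    obtain Z where Z: "Z \<subseteq> visible_edges E B" "odd_ends (\<lambda>e. e) Z = {r, q'}"
      by (rule blue_shortcut[OF nz2 un2 rB q' khull]) blast
    have finZ: "finite Z" using finite_subset[OF Z(1) finite_visible_edges[OF finite_B]] .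
    have "odd_ends (\<lambda>e. e) (sym_diff Y Z) = sym_diff (sym_diff {q} {r}) {r, q'}"
      using odd_ends_sym_diff[OF finY finZ, of "\<lambda>e. e"] Y(2) Z(2) by simp
    also have "\<dots> = {q, q'}" using False qq' by auto
    finally show ?thesis using that[of "sym_diff Y Z"] Y' Z(1) by blast
  qed
qed

section \<open>The hull boundary with contracted segments\<close>

context disjoint_segments
begin

lemma common_vertex: "e \<in> E \<Longrightarrow> f \<in> E \<Longrightarrow> v \<in> e \<Longrightarrow> v \<in> f \<Longrightarrow> e = f"
  using endpoint_unique[of e f v] by (simp add: edge_segment_def hull_inc)

abbreviation "V \<equiv> \<Union>E"

text \<open>Hull edges that are segments disappear under contraction and are therefore left
  out.\<close>

definition hull_links :: "point set set" where
  "hull_links = {{p, q} | p q. hull_edge V p q} - E"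

abbreviation touched :: "point set \<Rightarrow> point set set" where
  "touched j \<equiv> {e \<in> E. e \<inter> j \<noteq> {}}"

lemma touched_pair:
  assumes "e \<in> E" "f \<in> E" "p \<in> e" "q \<in> f"
  shows "touched {p, q} = {e, f}"
proof -
  have "g = e \<or> g = f" if "g \<in> touched {p, q}" for g
    using that assms common_vertex[of e g p] common_vertex[of f g q] by auto
  then show ?thesis using assms by blast
qed

lemma finite_hull_links: "finite hull_links"
  by (rule finite_subset[of _ "Pow V"]) (auto simp: hull_links_def hull_edge_def finite_V)

lemma card_V: "card V = 2 * card E"
proof -
  have "card V = (\<Sum>e\<in>E. card e)"
  proof (rule card_Union_disjoint)
    show "pairwise disjnt E"
      unfolding pairwise_def disjnt_def
    proof (intro ballI impI)
      fix e f assume "e \<in> E" "f \<in> E" "e \<noteq> f"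
      then have "edge_segment e \<inter> edge_segment f = {}" by (rule disj)
      moreover have "e \<subseteq> edge_segment e" "f \<subseteq> edge_segment f"
        by (simp_all add: edge_segment_def hull_subset)
      ultimately show "e \<inter> f = {}" by blast
    qed
    show "finite e" if "e \<in> E" for e using pairs[OF that] by auto
  qed
  also have "\<dots> = (\<Sum>e\<in>E. 2)" using pairs by (intro sum.cong refl) (metis card_2_iff)
  finally show ?thesis by simp
qed

text \<open>The contracted boundary is connected: from \<open>h\<close> one climbs along neighbours
  to the maximum \<open>t\<close> of \<open>l\<close>, with ever fewer vertices above. A step along
  a segment stays at the same contracted vertex; every other step adds a link.\<close>

lemma hull_links_connect:
  assumes c3: "card V \<ge> 3" and t: "hull_vertex V t" and e0: "e0 \<in> E" "t \<in> e0"
    and h: "hull_vertex V h" and e: "e \<in> E" "h \<in> e"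
  shows "\<exists>Y\<subseteq>hull_links. odd_ends touched Y = sym_diff {e} {e0}"
proof -
  obtain l where l: "\<forall>v\<in>V - {t}. l \<bullet> v < l \<bullet> t" using t unfolding hull_vertex_def by blast
  show ?thesis using h e
  proof (induction "card {v \<in> V. l \<bullet> h < l \<bullet> v}" arbitrary: h e rule: less_induct)
    case less
    show ?case
    proof (cases "h = t")
      case True
      then have "e = e0" using less.prems e0 common_vertex by metis
      then show ?thesis by (intro exI[of _ "{}"]) auto
    next
      case False
      have "t \<in> V" using e0 by auto
      moreover have "l \<bullet> h < l \<bullet> t" using l False less.prems by auto
      ultimately obtain k where k: "hull_edge V h k" "l \<bullet> h < l \<bullet> k"
        by (rule hull_neighbour_ascend[OF finite_V gp less.prems(1) c3]) blast
      have kv: "hull_vertex V k" using hull_edge_vertices[OF finite_V k(1)] by simp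
      then obtain f where f: "f \<in> E" "k \<in> f" by (auto simp: hull_vertex_def)
      have "k \<in> V" using f by auto
      have "card {v \<in> V. l \<bullet> k < l \<bullet> v} < card {v \<in> V. l \<bullet> h < l \<bullet> v}"
      proof (rule psubset_card_mono)
        show "finite {v \<in> V. l \<bullet> h < l \<bullet> v}" using finite_V by (rule rev_finite_subset) blast
        have "k \<in> {v \<in> V. l \<bullet> h < l \<bullet> v}" "k \<notin> {v \<in> V. l \<bullet> k < l \<bullet> v}" using k \<open>k \<in> V\<close> by simp_all
        moreover have "{v \<in> V. l \<bullet> k < l \<bullet> v} \<subseteq> {v \<in> V. l \<bullet> h < l \<bullet> v}" using k(2) by force
        ultimately show "{v \<in> V. l \<bullet> k < l \<bullet> v} \<subset> {v \<in> V. l \<bullet> h < l \<bullet> v}" by blast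
      qed
      then obtain Y where Y: "Y \<subseteq> hull_links" "odd_ends touched Y = sym_diff {f} {e0}"
        using less.hyps[of k f] kv f by blast
      show ?thesis
      proof (cases "{h, k} \<in> E")
        case True
        have "{h, k} = e" by (rule common_vertex[OF True less.prems(2), of h]) (use less.prems in auto)
        moreover have "{h, k} = f" by (rule common_vertex[OF True f(1), of k]) (use f in auto)
        ultimately have "e = f" by simp
        then show ?thesis using Y by blast
      next
        case False
        have fin: "finite Y" using finite_subset[OF Y(1) finite_hull_links] .
        have "e \<noteq> f"
        proof
          assume "e = f"
          then have "e = {h, k}" using less.prems f pairs[of e] k(1) by (auto simp: hull_edge_def)
          then show False using False less.prems by simp
        qed
        have "odd_ends touched (sym_diff {{h, k}} Y) = sym_diff (touched {h, k}) (sym_diff {f} {e0})"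
          using odd_ends_sym_diff[of "{{h, k}}" Y touched] fin Y by simp
        also have "touched {h, k} = {e, f}" using touched_pair less.prems f by blast
        also have "sym_diff {e, f} (sym_diff {f} {e0}) = sym_diff {e} {e0}" using \<open>e \<noteq> f\<close> by auto
        finally have "odd_ends touched (sym_diff {{h, k}} Y) = sym_diff {e} {e0}" .
        moreover have "{h, k} \<in> hull_links" unfolding hull_links_def using k(1) False by blast
        ultimately show ?thesis using Y(1) by (intro exI[of _ "sym_diff {{h, k}} Y"]) auto
      qed
    qed
  qed
qed

end

locale hull_connected = disjoint_segments +
  assumes even_E: "even (card E)" and nonempty: "E \<noteq> {}"
    and on_hull: "e \<in> E \<Longrightarrow> \<exists>p\<in>e. hull_vertex V p"
    and no_chord: "{p, q} \<in> E \<Longrightarrow> hull_vertex V p \<Longrightarrow> hull_vertex V q \<Longrightarrow> hull_edge V p q"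
begin

text \<open>Evenness excludes a single segment; the lemmas on hull neighbours need a third
  vertex.\<close>

lemma card_V_ge_3: "card V \<ge> 3"
proof -
  have "card E \<noteq> 0" using nonempty finite_E by simp
  then have "card E \<ge> 2" using even_E by presburger
  then show ?thesis using card_V by simp
qed

text \<open>Each segment is joined to a fixed \<open>e0\<close> and the paths are added modulo 2.
  The contributions of \<open>e0\<close> cancel because the number of segments is even.\<close>

lemma hull_links_odd: "\<exists>Y\<subseteq>hull_links. odd_ends touched Y = E"
proof -
  obtain e0 where e0: "e0 \<in> E" using nonempty by blast
  obtain t where t: "t \<in> e0" "hull_vertex V t" using on_hull[OF e0] by blast
  have "F \<subseteq> E \<Longrightarrow> \<exists>Y\<subseteq>hull_links. odd_ends touched Y = sym_diff F (if odd (card F) then {e0} else {})"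
    if "finite F" for F
    using that
  proof (induction F rule: finite_induct)
    case empty
    then show ?case by (intro exI[of _ "{}"]) auto
  next
    case (insert e F)
    obtain Y where Y: "Y \<subseteq> hull_links" "odd_ends touched Y = sym_diff F (if odd (card F) then {e0} else {})"
      using insert by blast
    obtain h where h: "h \<in> e" "hull_vertex V h" using on_hull insert.prems by blast
    have eE: "e \<in> E" using insert.prems by simp
    obtain Z where Z: "Z \<subseteq> hull_links" "odd_ends touched Z = sym_diff {e} {e0}"
      using hull_links_connect[OF card_V_ge_3 t(2) e0 t(1) h(2) eE h(1)] by blast
    have fin: "finite Y" "finite Z"
      using finite_subset[OF Y(1) finite_hull_links] finite_subset[OF Z(1) finite_hull_links] .
    have "odd_ends touched (sym_diff Y Z) =
        sym_diff (sym_diff F (if odd (card F) then {e0} else {})) (sym_diff {e} {e0})"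
      using odd_ends_sym_diff[OF fin, of touched] Y Z by simp
    also have "\<dots> = sym_diff (insert e F) (if odd (card (insert e F)) then {e0} else {})"
      using insert.hyps by (cases "odd (card F)") auto
    finally show ?case using Y(1) Z(1) by (intro exI[of _ "sym_diff Y Z"]) auto
  qed
  from this[OF finite_E] show ?thesis using even_E by simp
qed

lemma hull_link_at:
  assumes h: "hull_vertex V h"
  obtains k1 k2 where "hull_edge V h k1" "hull_edge V h k2" "k1 \<noteq> k2"
    "\<And>j. j \<in> hull_links \<Longrightarrow> h \<in> j \<Longrightarrow> j = {h, k1} \<or> j = {h, k2}"
    "\<And>k. hull_edge V h k \<Longrightarrow> k = k1 \<or> k = k2"
proof -
  obtain k1 k2 where k: "k1 \<noteq> k2" "hull_edge V h k1" "hull_edge V h k2"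
    and cone: "\<And>v. v \<in> V \<Longrightarrow> \<exists>s\<ge>0. \<exists>t\<ge>0. v - h = s *\<^sub>R (k1 - h) + t *\<^sub>R (k2 - h)"
    using hull_neighbours[OF finite_V gp h card_V_ge_3] by metis
  have kV: "k1 \<in> V" "k2 \<in> V" "k1 \<noteq> h" "k2 \<noteq> h" using k unfolding hull_edge_def by auto
  have u: "k = k1 \<or> k = k2" if "hull_edge V h k" for k
    by (rule hull_neighbour_unique[OF cone kV that])
  have "j = {h, k1} \<or> j = {h, k2}" if j: "j \<in> hull_links" "h \<in> j" for j
  proof -
    obtain p q where pq: "hull_edge V p q" "j = {p, q}" using j unfolding hull_links_def by blast
    then have "\<exists>k. hull_edge V h k \<and> j = {h, k}"
      using j(2) hull_edge_sym by (auto simp: insert_commute)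
    then show ?thesis using u by blast
  qed
  then show ?thesis using that k u by blast
qed

text \<open>A single hull endpoint lies on two hull edges. If both endpoints are on the hull, then
  by \<open>no_chord\<close> the segment is one of the two hull edges at either end, which leaves at
  most one link at each.\<close>

lemma few_hull_links:
  assumes e: "e \<in> E"
  shows "card {j \<in> hull_links. e \<in> touched j} \<le> 2"
proof -
  obtain p where p: "p \<in> e" "hull_vertex V p" using on_hull[OF e] by blast
  obtain q where q: "e = {p, q}" "p \<noteq> q" using pairs[OF e] p by auto
  have link_vertex: "hull_vertex V v" if "j \<in> hull_links" "v \<in> j" for j v
    using that hull_edge_vertices[OF finite_V] unfolding hull_links_def by blast
  obtain k1 k2 where k: "hull_edge V p k1" "hull_edge V p k2" "k1 \<noteq> k2"
    "\<And>j. j \<in> hull_links \<Longrightarrow> p \<in> j \<Longrightarrow> j = {p, k1} \<or> j = {p, k2}"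
    "\<And>k. hull_edge V p k \<Longrightarrow> k = k1 \<or> k = k2"
    by (rule hull_link_at[OF p(2)]) blast
  have "\<exists>A B. {j \<in> hull_links. e \<in> touched j} \<subseteq> {A, B}"
  proof (cases "hull_vertex V q")
    case False
    have "j = {p, k1} \<or> j = {p, k2}" if "j \<in> hull_links" "e \<in> touched j" for j
      using that k(4)[OF that(1)] link_vertex[OF that(1)] False q by auto
    then show ?thesis by blast
  next
    case True
    have ne: "e \<notin> hull_links" using e unfolding hull_links_def by blast
    have pq: "hull_edge V p q" using no_chord p True e q by blast
    obtain k where kp: "\<And>j. j \<in> hull_links \<Longrightarrow> p \<in> j \<Longrightarrow> j = {p, k}"
    proof -
      have "k1 = q \<or> k2 = q" using k(5)[OF pq] by blast
      moreover have "j \<noteq> {p, q}" if "j \<in> hull_links" for j using ne q that by auto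
      ultimately show ?thesis using k(4) that by metis
    qed
    obtain m1 m2 where m: "\<And>j. j \<in> hull_links \<Longrightarrow> q \<in> j \<Longrightarrow> j = {q, m1} \<or> j = {q, m2}"
      "\<And>k. hull_edge V q k \<Longrightarrow> k = m1 \<or> k = m2"
      by (rule hull_link_at[OF True]) blast
    obtain m where mq: "\<And>j. j \<in> hull_links \<Longrightarrow> q \<in> j \<Longrightarrow> j = {q, m}"
    proof -
      have "m1 = p \<or> m2 = p" using m(2)[OF hull_edge_sym[OF pq]] by blast
      moreover have "j \<noteq> {q, p}" if "j \<in> hull_links" for j using ne q that by (auto simp: insert_commute)
      ultimately show ?thesis using m(1) that by metis
    qed
    have "j = {p, k} \<or> j = {q, m}" if "j \<in> hull_links" "e \<in> touched j" for j
      using that kp mq q by auto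
    then show ?thesis by blast
  qed
  then obtain A B where "{j \<in> hull_links. e \<in> touched j} \<subseteq> {A, B}" by blast
  then have "card {j \<in> hull_links. e \<in> touched j} \<le> card {A, B}" by (intro card_mono) auto
  also have "\<dots> \<le> 2" by (simp add: card_insert_if)
  finally show ?thesis .
qed

text \<open>An odd degree that is at most 2 is 1.\<close>

lemma red_matching:
  obtains J where "J \<subseteq> hull_links" "\<And>e. e \<in> E \<Longrightarrow> \<exists>!j. j \<in> J \<and> e \<inter> j \<noteq> {}"
proof -
  obtain J where J: "J \<subseteq> hull_links" "odd_ends touched J = E" using hull_links_odd by blast
  have "\<exists>!j. j \<in> J \<and> e \<inter> j \<noteq> {}" if e: "e \<in> E" for e
  proof -
    have "card {j \<in> J. e \<in> touched j} \<le> card {j \<in> hull_links. e \<in> touched j}"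
      using J(1) finite_hull_links by (intro card_mono) auto
    then have "card {j \<in> J. e \<in> touched j} \<le> 2" using few_hull_links[OF e] by linarith
    moreover have "odd (card {j \<in> J. e \<in> touched j})" using J(2) e unfolding odd_ends_def by blast
    ultimately have "card {j \<in> J. e \<in> touched j} = 1" by presburger
    then obtain j where j: "{j \<in> J. e \<in> touched j} = {j}" by (rule card_1_singletonE)
    have "j' \<in> J \<and> e \<inter> j' \<noteq> {} \<longleftrightarrow> j' \<in> {j \<in> J. e \<in> touched j}" for j' using e by simp
    then show ?thesis unfolding j by simp
  qed
  then show ?thesis using that J(1) by blast
qed

end

section \<open>Combining the two matchings\<close>

text \<open>The conclusion for bare edge sets on the vertices \<open>\<Union>E\<close>, a form in
  which the induction can pass to subsets of the segments.\<close>

definition disjoint_compatible :: "point set set \<Rightarrow> point set set \<Rightarrow> bool" where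
  "disjoint_compatible E E' \<longleftrightarrow>
     (\<forall>e\<in>E \<union> E'. \<exists>p\<in>\<Union>E. \<exists>q\<in>\<Union>E. p \<noteq> q \<and> e = {p, q}) \<and>
     (\<forall>v\<in>\<Union>E. \<exists>!e. e \<in> E' \<and> v \<in> e) \<and> E \<inter> E' = {} \<and>
     (\<forall>e\<in>E \<union> E'. \<forall>f\<in>E \<union> E'. e \<noteq> f \<longrightarrow> edge_segment e \<inter> edge_segment f \<subseteq> e \<inter> f)"

lemma disjoint_compatibleD:
  assumes d: "disjoint_compatible E E'"
  shows "e \<in> E \<union> E' \<Longrightarrow> \<exists>p\<in>\<Union>E. \<exists>q\<in>\<Union>E. p \<noteq> q \<and> e = {p, q}"
    and "v \<in> \<Union>E \<Longrightarrow> \<exists>!e. e \<in> E' \<and> v \<in> e"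
    and "E \<inter> E' = {}"
    and "e \<in> E \<union> E' \<Longrightarrow> f \<in> E \<union> E' \<Longrightarrow> e \<noteq> f \<Longrightarrow> edge_segment e \<inter> edge_segment f \<subseteq> e \<inter> f"
proof -
  note d' = d[unfolded disjoint_compatible_def]
  show "e \<in> E \<union> E' \<Longrightarrow> \<exists>p\<in>\<Union>E. \<exists>q\<in>\<Union>E. p \<noteq> q \<and> e = {p, q}"
    using d'[THEN conjunct1] by (rule bspec)
  show "v \<in> \<Union>E \<Longrightarrow> \<exists>!e. e \<in> E' \<and> v \<in> e"
    using d'[THEN conjunct2, THEN conjunct1] by (rule bspec)
  show "E \<inter> E' = {}"
    by (rule d'[THEN conjunct2, THEN conjunct2, THEN conjunct1])
  show "e \<in> E \<union> E' \<Longrightarrow> f \<in> E \<union> E' \<Longrightarrow> e \<noteq> f \<Longrightarrow> edge_segment e \<inter> edge_segment f \<subseteq> e \<inter> f"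
    using d'[THEN conjunct2, THEN conjunct2, THEN conjunct2] by (meson bspec)
qed

lemma (in hull_connected) exists_disjoint_compatible: "\<exists>E'. disjoint_compatible E E'"
proof -
  obtain J where J: "J \<subseteq> hull_links" and unique: "\<And>e. e \<in> E \<Longrightarrow> \<exists>!j. j \<in> J \<and> e \<inter> j \<noteq> {}"
    by (rule red_matching) blast
  have JE: "j \<notin> E" if "j \<in> J" for j using J that unfolding hull_links_def by blast
  have J_edge: "\<exists>h k. hull_edge V h k \<and> j = {h, k}" if "j \<in> J" for j
    using J that unfolding hull_links_def by blast
  have same: "j = j'" if "e \<in> E" "j \<in> J" "j' \<in> J" "e \<inter> j \<noteq> {}" "e \<inter> j' \<noteq> {}" for e j j'
    using unique[OF that(1)] that by blast
  define B where "B = V - \<Union>J"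
  interpret blue_points E B
  proof
    show "B \<subseteq> V" by (auto simp: B_def)
    show "\<exists>p q. p \<noteq> q \<and> e = {p, q} \<and> p \<in> B \<and> q \<notin> B" if e: "e \<in> E" for e
    proof -
      obtain j where j: "j \<in> J" "e \<inter> j \<noteq> {}" using unique[OF e] by blast
      then obtain q where q: "q \<in> e" "q \<in> j" by blast
      obtain p where p: "e = {p, q}" "p \<noteq> q" using pairs[OF e] q by auto
      \<comment> \<open>If both endpoints were red, the only link touching \<open>e\<close> would
        contain both and equal \<open>e\<close>, but links are not segments.\<close>
      have "p \<notin> \<Union>J"
      proof
        assume "p \<in> \<Union>J"
        then obtain j' where j': "j' \<in> J" "p \<in> j'" by blast
        then have "j' = j" using same[OF e j'(1) j(1)] j p by blast
        then have "p \<in> j" using j' by simp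
        then have "j = e" using J_edge[OF j(1)] p q by auto
        then show False using JE j e by blast
      qed
      then have "p \<in> B" using p e unfolding B_def by auto
      moreover have "q \<notin> B" using q j unfolding B_def by auto
      ultimately show ?thesis using p by blast
    qed
    show "V \<inter> open_triangle a x b \<subseteq> B"
      if "a \<in> V" "b \<in> V" "a \<noteq> b" "x \<in> convex hull V" for a b x
    proof
      fix p assume p: "p \<in> V \<inter> open_triangle a x b"
      have "p \<notin> \<Union>J"
      proof
        assume "p \<in> \<Union>J"
        then obtain h k where "hull_edge V h k" "p \<in> {h, k}" using J_edge by fastforce
        then have "hull_vertex V p" using hull_edge_vertices[OF finite_V] by blast
        then show False using hull_vertex_not_in_triangle that p by blast
      qed
      then show "p \<in> B" using p unfolding B_def by blast
    qed
  qed
  \<comment> \<open>For one link, \<open>P\<close> gives the two ends of the path along it.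
    Different links of \<open>J\<close> touch different segments, so adding paths modulo 2 adds
    these pairs disjointly.\<close>
  define P where "P = (\<lambda>K. {v \<in> B. \<exists>e\<in>E. v \<in> e \<and> (\<exists>j\<in>K. e \<inter> j \<noteq> {})})"
  have path: "\<exists>Y\<subseteq>visible_edges E B. odd_ends (\<lambda>e. e) Y = P {j}" if j: "j \<in> J" for j
  proof -
    obtain h k where hk: "hull_edge V h k" "j = {h, k}" using J_edge[OF j] by blast
    have hV: "h \<in> V" "k \<in> V" using hk by (auto simp: hull_edge_def)
    obtain e where e: "e \<in> E" "h \<in> e" using hV by blast
    obtain f where f: "f \<in> E" "k \<in> f" using hV by blast
    have red: "h \<notin> B" "k \<notin> B" using j hk unfolding B_def by auto
    obtain q where q: "e = {h, q}" "q \<in> B" using blue[OF e(1)] e red by auto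
    obtain q' where q': "f = {k, q'}" "q' \<in> B" using blue[OF f(1)] f red by auto
    have "P {j} = {q, q'}"
    proof
      have "q \<in> e" "q' \<in> f" "e \<inter> {h, k} \<noteq> {}" "f \<inter> {h, k} \<noteq> {}" using q q' e f by auto
      then show "{q, q'} \<subseteq> P {j}" unfolding P_def hk(2) using q(2) q'(2) e(1) f(1) by auto
      show "P {j} \<subseteq> {q, q'}"
      proof
        fix v assume "v \<in> P {j}"
        then obtain g where g: "v \<in> B" "g \<in> E" "v \<in> g" "g \<inter> {h, k} \<noteq> {}" unfolding P_def hk(2) by auto
        then have "g = e \<or> g = f" using common_vertex[OF g(2) e(1), of h] common_vertex[OF g(2) f(1), of k] e f by auto
        then show "v \<in> {q, q'}" using g q q' red by auto
      qed
    qed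
    moreover obtain Y where "Y \<subseteq> visible_edges E B" "odd_ends (\<lambda>e. e) Y = {q, q'}"
      by (rule path_along_hull_edge[OF hk(1), of q q'])
        (use JE[OF j] hk(2) e f q q' red in auto)
    ultimately show ?thesis by auto
  qed
  have finJ: "finite J" using finite_subset[OF J finite_hull_links] .
  have "K \<subseteq> J \<Longrightarrow> \<exists>Y\<subseteq>visible_edges E B. odd_ends (\<lambda>e. e) Y = P K" if "finite K" for K
    using that
  proof (induction K rule: finite_induct)
    case empty
    show ?case by (intro exI[of _ "{}"]) (auto simp: P_def)
  next
    case (insert j K)
    obtain Y where Y: "Y \<subseteq> visible_edges E B" "odd_ends (\<lambda>e. e) Y = P K" using insert by blast
    obtain Z where Z: "Z \<subseteq> visible_edges E B" "odd_ends (\<lambda>e. e) Z = P {j}" using path insert.prems by blast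
    have fin: "finite Y" "finite Z"
      using finite_subset[OF Y(1)] finite_subset[OF Z(1)] finite_visible_edges[OF finite_B] by auto
    have "P K \<inter> P {j} = {}"
    proof (rule ccontr)
      assume "P K \<inter> P {j} \<noteq> {}"
      then obtain v where vP: "v \<in> P K" "v \<in> P {j}" by blast
      obtain e j' where e: "e \<in> E" "v \<in> e" "j' \<in> K" "e \<inter> j' \<noteq> {}" using vP(1) unfolding P_def by auto
      obtain f where f: "f \<in> E" "v \<in> f" "f \<inter> j \<noteq> {}" using vP(2) unfolding P_def by auto
      have "e = f" using common_vertex e f by blast
      moreover have "j' \<in> J" "j \<in> J" using e(3) insert.prems by auto
      ultimately have "j' = j" using same[of e j' j] e f by simp
      then show False using insert.hyps e(3) by blast
    qed
    moreover have "P (insert j K) = P K \<union> P {j}" unfolding P_def by auto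
    ultimately have "P (insert j K) = sym_diff (P K) (P {j})" by blast
    then have "odd_ends (\<lambda>e. e) (sym_diff Y Z) = P (insert j K)"
      using odd_ends_sym_diff[OF fin, of "\<lambda>e. e"] Y Z by simp
    then show ?case using Y(1) Z(1) by (intro exI[of _ "sym_diff Y Z"]) auto
  qed
  from this[OF finJ] obtain X0 where X0: "X0 \<subseteq> visible_edges E B" "odd_ends (\<lambda>e. e) X0 = P J" by blast
  have "P J = B"
  proof
    show "B \<subseteq> P J"
    proof
      fix v assume v: "v \<in> B"
      then obtain e where e: "e \<in> E" "v \<in> e" using B_sub by blast
      then obtain j where "j \<in> J" "e \<inter> j \<noteq> {}" using unique by blast
      then show "v \<in> P J" using v e unfolding P_def by blast
    qed
  qed (auto simp: P_def)
  then have X0B: "odd_ends (\<lambda>e. e) X0 = B" using X0(2) by simp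
  obtain X where X: "X \<subseteq> visible_edges E B"
    "\<And>e f. e \<in> X \<Longrightarrow> f \<in> X \<Longrightarrow> e \<noteq> f \<Longrightarrow> edge_segment e \<inter> edge_segment f \<subseteq> e \<inter> f"
    "\<And>v. v \<in> B \<Longrightarrow> card {e \<in> X. v \<in> e} = 1"
    by (rule blue_matching[OF X0(1) X0B]) blast
  have X_edge: "\<exists>p\<in>B. \<exists>q\<in>B. p \<noteq> q \<and> e = {p, q}" if "e \<in> X" for e
    using X(1) that unfolding visible_edges_def by blast
  have pair: "\<exists>p\<in>V. \<exists>q\<in>V. p \<noteq> q \<and> e = {p, q}" if e: "e \<in> E \<union> (J \<union> X)" for e
  proof -
    consider "e \<in> E" | "e \<in> J" | "e \<in> X" using e by blast
    then show ?thesis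
    proof cases
      case 1
      then obtain p q where "p \<noteq> q" "e = {p, q}" using pairs by blast
      then show ?thesis using 1 by blast
    next
      case 2
      then show ?thesis using J_edge[OF 2] unfolding hull_edge_def by blast
    next
      case 3
      then obtain p q where pq: "p \<in> B" "q \<in> B" "p \<noteq> q" "e = {p, q}" using X_edge by blast
      show ?thesis using pq(3,4) subsetD[OF B_sub pq(1)] subsetD[OF B_sub pq(2)] by metis
    qed
  qed
  have uniq: "\<exists>!e. e \<in> J \<union> X \<and> v \<in> e" if v: "v \<in> V" for v
  proof (cases "v \<in> B")
    case True
    obtain e where e: "{e \<in> X. v \<in> e} = {e}" using X(3)[OF True] by (rule card_1_singletonE)
    have "v \<notin> j" if "j \<in> J" for j using that True unfolding B_def by blast
    then have "f \<in> J \<union> X \<and> v \<in> f \<longleftrightarrow> f \<in> {e \<in> X. v \<in> e}" for f by auto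
    then show ?thesis unfolding e by simp
  next
    case False
    then obtain j where j: "j \<in> J" "v \<in> j" using v unfolding B_def by blast
    obtain e where e: "e \<in> E" "v \<in> e" using v by blast
    have "v \<notin> f" if "f \<in> X" for f using X_edge[OF that] False by blast
    moreover have "j' = j" if "j' \<in> J" "v \<in> j'" for j' using same[OF e(1) that(1) j(1)] that j e by blast
    ultimately show ?thesis using j by blast
  qed
  have disjEX: "E \<inter> (J \<union> X) = {}"
  proof -
    have "e \<notin> E" if "e \<in> X" for e using X_edge[OF that] blue_pair_not_edge by blast
    then show ?thesis using JE by blast
  qed
  have hull_side: "edge_segment j \<inter> edge_segment f \<subseteq> j \<inter> f"
    if j: "j \<in> J" and f: "f \<in> E \<union> (J \<union> X)" and jf: "j \<noteq> f" for j f
  proof -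
    obtain h k where hk: "hull_edge V h k" "j = {h, k}" using J_edge[OF j] by blast
    obtain p q where pq: "p \<in> V" "q \<in> V" "p \<noteq> q" "f = {p, q}" using pair[OF f] by blast
    show ?thesis unfolding hk(2) pq(4) edge_segment_pair
      by (rule hull_edge_noncrossing[OF hk(1) pq(1,2) _ pq(3)]) (use jf hk pq in auto)
  qed
  have vis_side: "edge_segment e \<inter> edge_segment f \<subseteq> e \<inter> f" if e: "e \<in> X" and f: "f \<in> E" for e f
  proof
    fix z assume z: "z \<in> edge_segment e \<inter> edge_segment f"
    have "e \<in> visible_edges E B" using X(1) e by blast
    then have ze: "z \<in> e" using visible_edgeD[of e f] f z by blast
    then have "z \<in> V" using X_edge[OF e] B_sub by blast
    then obtain g where g: "g \<in> E" "z \<in> g" by blast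
    then have "g = f" using endpoint_unique[OF g(1) f g(2)] z by blast
    then show "z \<in> e \<inter> f" using ze g by blast
  qed
  have "edge_segment e \<inter> edge_segment f \<subseteq> e \<inter> f"
    if e: "e \<in> E \<union> (J \<union> X)" and f: "f \<in> E \<union> (J \<union> X)" and ef: "e \<noteq> f" for e f
  proof -
    consider "e \<in> J" | "f \<in> J" | "e \<in> E" "f \<in> E" | "e \<in> X" "f \<in> E" | "e \<in> E" "f \<in> X" | "e \<in> X" "f \<in> X"
      using e f by blast
    then show ?thesis
    proof cases
      case 1
      then show ?thesis using hull_side f ef by blast
    next
      case 2
      then show ?thesis using hull_side[OF 2 e] ef by blast
    next
      case 3
      then show ?thesis using disj[OF 3 ef] by blast
    next
      case 4
      then show ?thesis by (rule vis_side)
    next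
      case 5
      then show ?thesis using vis_side[OF 5(2,1)] by blast
    next
      case 6
      then show ?thesis using X(2) ef by blast
    qed
  qed
  then have "disjoint_compatible E (J \<union> X)"
    unfolding disjoint_compatible_def by (intro conjI ballI impI pair uniq disjEX)
  then show ?thesis by blast
qed

section \<open>Splitting along a chord\<close>

text \<open>Half-planes are convex, so each contains all edges of its part and nothing meets across.
  One inequality is not strict, since the chord on the dividing line belongs to
  \<open>C\<close>.\<close>

lemma disjoint_compatible_Un:
  assumes A: "disjoint_compatible A A'" and C: "disjoint_compatible C C'"
    and posA: "\<And>p. p \<in> \<Union>A \<Longrightarrow> l \<bullet> p > c" and negC: "\<And>p. p \<in> \<Union>C \<Longrightarrow> l \<bullet> p \<le> c"
  shows "disjoint_compatible (A \<union> C) (A' \<union> C')"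
proof -
  have pA: "\<exists>p\<in>\<Union>A. \<exists>q\<in>\<Union>A. p \<noteq> q \<and> e = {p, q}" if "e \<in> A \<union> A'" for e
    by (rule disjoint_compatibleD(1)[OF A that])
  have pC: "\<exists>p\<in>\<Union>C. \<exists>q\<in>\<Union>C. p \<noteq> q \<and> e = {p, q}" if "e \<in> C \<union> C'" for e
    by (rule disjoint_compatibleD(1)[OF C that])
  have sA: "edge_segment e \<subseteq> {y. l \<bullet> y > c}" if "e \<in> A \<union> A'" for e
    unfolding edge_segment_def
    by (rule hull_minimal) (use pA[OF that] posA in \<open>auto simp: convex_halfspace_gt\<close>)
  have sC: "edge_segment e \<subseteq> {y. l \<bullet> y \<le> c}" if "e \<in> C \<union> C'" for e
    unfolding edge_segment_def
    by (rule hull_minimal) (use pC[OF that] negC in \<open>auto simp: convex_halfspace_le\<close>)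
  have far: "edge_segment e \<inter> edge_segment f = {}" if "e \<in> A \<union> A'" "f \<in> C \<union> C'" for e f
    using sA[OF that(1)] sC[OF that(2)] by force
  have sep: "v \<notin> \<Union>C" if "v \<in> \<Union>A" for v using posA[OF that] negC by force
  have 1: "\<exists>p\<in>\<Union>(A \<union> C). \<exists>q\<in>\<Union>(A \<union> C). p \<noteq> q \<and> e = {p, q}" if "e \<in> (A \<union> C) \<union> (A' \<union> C')" for e
  proof (cases "e \<in> A \<union> A'")
    case True
    then show ?thesis using pA[OF True] by blast
  next
    case False
    then have "e \<in> C \<union> C'" using that by blast
    from pC[OF this] show ?thesis by blast
  qed
  have inA: "v \<in> \<Union>A" if "e \<in> A \<union> A'" "v \<in> e" for e v using pA[OF that(1)] that(2) by blast
  have inC: "v \<in> \<Union>C" if "e \<in> C \<union> C'" "v \<in> e" for e v using pC[OF that(1)] that(2) by blast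
  have 2: "\<exists>!e. e \<in> A' \<union> C' \<and> v \<in> e" if v: "v \<in> \<Union>(A \<union> C)" for v
  proof (cases "v \<in> \<Union>A")
    case True
    then have "\<exists>!e. e \<in> A' \<and> v \<in> e" by (rule disjoint_compatibleD(2)[OF A])
    moreover have "v \<notin> e" if "e \<in> C'" for e using inC[of e v] that sep[OF True] by blast
    ultimately show ?thesis by blast
  next
    case False
    then have "v \<in> \<Union>C" using v by blast
    then have "\<exists>!e. e \<in> C' \<and> v \<in> e" by (rule disjoint_compatibleD(2)[OF C])
    moreover have "v \<notin> e" if "e \<in> A'" for e using inA[of e v] that False by blast
    ultimately show ?thesis by blast
  qed
  have apart: "e \<noteq> f" if "e \<in> A \<union> A'" "f \<in> C \<union> C'" for e f
  proof
    assume "e = f"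
    then have "edge_segment e = {}" using far[OF that] by simp
    then have "e = {}" by (simp add: edge_segment_def)
    then show False using pA[OF that(1)] by blast
  qed
  have 3: "(A \<union> C) \<inter> (A' \<union> C') = {}"
    using disjoint_compatibleD(3)[OF A] disjoint_compatibleD(3)[OF C] apart by blast
  have 4: "edge_segment e \<inter> edge_segment f \<subseteq> e \<inter> f"
    if e: "e \<in> (A \<union> C) \<union> (A' \<union> C')" and f: "f \<in> (A \<union> C) \<union> (A' \<union> C')" and ef: "e \<noteq> f" for e f
  proof -
    consider "e \<in> A \<union> A'" "f \<in> A \<union> A'" | "e \<in> C \<union> C'" "f \<in> C \<union> C'"
      | "e \<in> A \<union> A'" "f \<in> C \<union> C'" | "f \<in> A \<union> A'" "e \<in> C \<union> C'" using e f by blast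
    then show ?thesis
    proof cases
      case 1
      then show ?thesis using disjoint_compatibleD(4)[OF A] ef by blast
    next
      case 2
      then show ?thesis using disjoint_compatibleD(4)[OF C] ef by blast
    next
      case 3
      then show ?thesis using far by blast
    next
      case 4
      then show ?thesis using far by blast
    qed
  qed
  show ?thesis unfolding disjoint_compatible_def by (intro conjI ballI impI 1 2 3 4)
qed

text \<open>Otherwise the segment meets the line \<open>uv\<close> in a point \<open>z\<close>
  spanned by vertices other than \<open>u\<close> and \<open>v\<close>. Extremality of
  \<open>u\<close> and \<open>v\<close> puts \<open>z\<close> between them, hence on the chord,
  against disjointness.\<close>

lemma (in disjoint_segments) chord_separates:
  assumes uv: "{u, v} \<in> E" and u: "hull_vertex V u" and v: "hull_vertex V v" and ne: "u \<noteq> v"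
    and e: "e \<in> E" "e \<noteq> {u, v}" and p: "p \<in> e" and q: "q \<in> e"
    and pos: "cross2 (v - u) (p - u) > 0"
  shows "cross2 (v - u) (q - u) > 0"
proof (rule ccontr)
  define G where "G = (\<lambda>p. cross2 (v - u) (p - u))"
  assume "\<not> cross2 (v - u) (q - u) > 0"
  then have neg: "G q \<le> 0" and pos': "G p > 0" using pos by (simp_all add: G_def)
  have notin: "u \<notin> e" "v \<notin> e" using common_vertex[OF e(1) uv] e(2) by auto
  have V: "u \<in> V" "v \<in> V" "p \<in> V" "q \<in> V" using uv e p q by auto
  define t where "t = G p / (G p - G q)"
  have t: "0 < t" "t \<le> 1" "(1 - t) * G p + t * G q = 0"
    using pos' neg by (auto simp: t_def field_simps)
  define z where "z = (1 - t) *\<^sub>R p + t *\<^sub>R q"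
  have Gz: "G z = 0" using t(3) unfolding G_def z_def by (simp add: cross2_def algebra_simps)
  have zpq: "z \<in> closed_segment p q" using t unfolding z_def in_segment by (intro exI[of _ t]) auto
  have ze: "z \<in> edge_segment e"
    using zpq p q unfolding edge_segment_def
    by (meson closed_segment_subset convex_convex_hull hull_inc subsetD)
  have "v - u \<noteq> 0" using ne by simp
  then have n: "(v - u) \<bullet> (v - u) \<noteq> 0" by simp
  \<comment> \<open>The coordinate of \<open>z\<close> on the line \<open>uv\<close>, by orthogonal
    projection. The functional of \<open>u\<close> then yields \<open>w > 0\<close>, that of
    \<open>v\<close> yields \<open>w < 1\<close>.\<close>
  define w where "w = ((z - u) \<bullet> (v - u)) / ((v - u) \<bullet> (v - u))"
  have "((v - u) \<bullet> (v - u)) *\<^sub>R (z - u) = ((z - u) \<bullet> (v - u)) *\<^sub>R (v - u)"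
  proof -
    have c: "(v - u) $ 1 * (z - u) $ 2 = (v - u) $ 2 * (z - u) $ 1" using Gz by (simp add: G_def cross2_def)
    show ?thesis
      unfolding vec2_eq_iff inner2 using c by (simp add: distrib_right distrib_left) (metis (no_types, opaque_lifting) mult.assoc mult.commute)
  qed
  then have "(1 / ((v - u) \<bullet> (v - u))) *\<^sub>R (((v - u) \<bullet> (v - u)) *\<^sub>R (z - u)) = w *\<^sub>R (v - u)"
    by (simp add: w_def)
  then have "z - u = w *\<^sub>R (v - u)" using n by simp
  then have zw: "z = u + w *\<^sub>R (v - u)" by (simp add: algebra_simps)
  have l_less: "l \<bullet> z < l \<bullet> x" if "\<forall>y\<in>V - {x}. l \<bullet> y < l \<bullet> x" "x \<notin> e" for l x
  proof -
    have "p \<noteq> x" "q \<noteq> x" using that p q by auto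
    then have "l \<bullet> p < l \<bullet> x" "l \<bullet> q < l \<bullet> x" using that V by auto
    then have "p \<in> {y. l \<bullet> y < l \<bullet> x}" "q \<in> {y. l \<bullet> y < l \<bullet> x}" by auto
    then show ?thesis using zpq closed_segment_subset[OF _ _ convex_halfspace_lt] by blast
  qed
  obtain lu where lu: "\<forall>y\<in>V - {u}. lu \<bullet> y < lu \<bullet> u" using u unfolding hull_vertex_def by blast
  obtain lv where lv: "\<forall>y\<in>V - {v}. lv \<bullet> y < lv \<bullet> v" using v unfolding hull_vertex_def by blast
  have "w * (lu \<bullet> (v - u)) < 0" using l_less[OF lu notin(1)] unfolding zw by (simp add: inner_add_right)
  moreover have "lu \<bullet> (v - u) < 0" using lu V ne by (simp add: inner_diff_right)
  ultimately have w0: "w > 0" by (simp add: mult_less_0_iff)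
  have "lv \<bullet> z - lv \<bullet> v = (w - 1) * (lv \<bullet> (v - u))" unfolding zw by (simp add: inner_add_right inner_diff_right algebra_simps)
  moreover have "lv \<bullet> z - lv \<bullet> v < 0" using l_less[OF lv notin(2)] by simp
  moreover have "lv \<bullet> (v - u) > 0" using lv V ne by (simp add: inner_diff_right)
  ultimately have w1: "w < 1" by (simp add: mult_less_0_iff)
  have "z = (1 - w) *\<^sub>R u + w *\<^sub>R v" unfolding zw by (simp add: algebra_simps)
  then have "z \<in> closed_segment u v" using w0 w1 unfolding in_segment by (intro exI[of _ w]) auto
  then show False using disj[OF e(1) uv e(2)] ze by (auto simp: edge_segment_pair)
qed

lemma disjoint_segments_subset:
  assumes "disjoint_segments E" "A \<subseteq> E"
  shows "disjoint_segments A"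
proof -
  interpret disjoint_segments E by fact
  show ?thesis
  proof
    show "finite A" using assms(2) finite_E finite_subset by blast
    show "in_gen_pos (\<Union>A)" using in_gen_pos_mono[OF gp] assms(2) by blast
  qed (use assms(2) pairs disj in blast)+
qed

text \<open>A hull vertex stays one in every part that contains it, so a split only has to respect
  parity and leave both parts proper.\<close>

lemma convex_hull_connected_disjoint_compatible:
  assumes "disjoint_segments E" "even (card E)" "\<And>e. e \<in> E \<Longrightarrow> \<exists>p\<in>e. hull_vertex (\<Union>E) p"
  shows "\<exists>E'. disjoint_compatible E E'"
  using assms
proof (induction "card E" arbitrary: E rule: less_induct)
  case less
  interpret disjoint_segments E by (rule less.prems(1))
  note even = less.prems(2) and on_hull = less.prems(3)
  consider (empty) "E = {}"
    | (plain) "E \<noteq> {}" "\<forall>p q. {p, q} \<in> E \<longrightarrow> hull_vertex V p \<longrightarrow> hull_vertex V q \<longrightarrow> hull_edge V p q"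
    | (chord) u v where "{u, v} \<in> E" "hull_vertex V u" "hull_vertex V v" "\<not> hull_edge V u v"
    by blast
  then show ?case
  proof cases
    case empty
    then have "disjoint_compatible E {}" by (simp add: disjoint_compatible_def)
    then show ?thesis by blast
  next
    case plain
    interpret hull_connected E
      by unfold_locales (use plain even on_hull in auto)
    show ?thesis by (rule exists_disjoint_compatible)
  next
    case chord
    have V: "u \<in> V" "v \<in> V" using chord(1) by auto
    have ne: "u \<noteq> v" using pairs[OF chord(1)] by (auto simp: doubleton_eq_iff)
    define G where "G = (\<lambda>p. cross2 (v - u) (p - u))"
    have G0: "G p \<noteq> 0" if "p \<in> V" "p \<noteq> u" "p \<noteq> v" for p
      using in_gen_posD[OF gp V that(1)] ne that unfolding G_def by auto
    have G_swap: "cross2 (u - v) (p - v) = - G p" for p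
      unfolding G_def by (simp add: cross2_def algebra_simps)
    define L where "L = {e \<in> E. \<forall>p\<in>e. G p > 0}"
    define R where "R = {e \<in> E. \<forall>p\<in>e. G p < 0}"
    have notin: "u \<notin> e" "v \<notin> e" if "e \<in> E" "e \<noteq> {u, v}" for e
      using common_vertex[OF that(1) chord(1)] that(2) by auto
    have side: "e \<in> L \<or> e \<in> R" if e: "e \<in> E" "e \<noteq> {u, v}" for e
    proof -
      obtain p q where pq: "e = {p, q}" using pairs[OF e(1)] by blast
      have p: "p \<in> e" "p \<in> V" using pq e by auto
      have "G p \<noteq> 0" using G0[OF p(2)] notin[OF e] p by auto
      then consider "G p > 0" | "G p < 0" by linarith
      then show ?thesis
      proof cases
        case 1
        then have "G r > 0" if "r \<in> e" for r
          using chord_separates[OF chord(1,2,3) ne e p(1) that] unfolding G_def by blast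
        then show ?thesis using e(1) unfolding L_def by blast
      next
        case 2
        have vu: "{v, u} \<in> E" "e \<noteq> {v, u}" using chord(1) e(2) by (auto simp: insert_commute)
        have "G r < 0" if "r \<in> e" for r
          using chord_separates[OF vu(1) chord(3,2) ne[symmetric] e(1) vu(2) p(1) that] 2 unfolding G_swap by simp
        then show ?thesis using e(1) unfolding R_def by blast
      qed
    qed
    have Guv: "G u = 0" "G v = 0" unfolding G_def by (simp_all add: cross2_def)
    have uvLR: "{u, v} \<notin> L" "{u, v} \<notin> R" unfolding L_def R_def using Guv by auto
    have E_eq: "E = insert {u, v} (L \<union> R)" using side chord(1) unfolding L_def R_def by blast
    have LR: "L \<inter> R = {}"
    proof -
      have "\<not> (e \<in> L \<and> e \<in> R)" for e
      proof
        assume e: "e \<in> L \<and> e \<in> R"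
        then obtain p where "p \<in> e" using pairs[of e] unfolding L_def by blast
        then show False using e unfolding L_def R_def by force
      qed
      then show ?thesis by blast
    qed
    have finLR: "finite L" "finite R" using finite_E unfolding L_def R_def by auto
    have cardE: "card E = Suc (card L + card R)"
    proof -
      have "card (insert {u, v} (L \<union> R)) = Suc (card (L \<union> R))" using finLR uvLR by simp
      then show ?thesis using E_eq card_Un_disjoint[OF finLR LR] by simp
    qed
    have Lin: "(rot (v - u)) \<bullet> p = G p + (rot (v - u)) \<bullet> u" for p
      unfolding inner_rot G_def by (simp add: cross2_def algebra_simps)
    \<comment> \<open>An empty side would make the chord a hull edge. Both sides being nonempty, the
      part that receives the chord is still smaller than \<open>E\<close>.\<close>
    have L_ne: "L \<noteq> {}"
    proof
      assume "L = {}"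
      have "rot (v - u) \<bullet> p < rot (v - u) \<bullet> u" if p: "p \<in> V - {u, v}" for p
      proof -
        obtain e where e: "e \<in> E" "p \<in> e" using p by blast
        have "e \<noteq> {u, v}" using p e by auto
        then have "G p < 0" using side[OF e(1)] \<open>L = {}\<close> e(2) unfolding R_def by blast
        then show ?thesis using Lin[of p] by simp
      qed
      moreover have "rot (v - u) \<bullet> u = rot (v - u) \<bullet> v" using Lin[of v] Guv by simp
      ultimately have "hull_edge V u v" unfolding hull_edge_def using V ne by blast
      then show False using chord by blast
    qed
    have R_ne: "R \<noteq> {}"
    proof
      assume "R = {}"
      have "(- rot (v - u)) \<bullet> p < (- rot (v - u)) \<bullet> u" if p: "p \<in> V - {u, v}" for p
      proof -
        obtain e where e: "e \<in> E" "p \<in> e" using p by blast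
        have "e \<noteq> {u, v}" using p e by auto
        then have "G p > 0" using side[OF e(1)] \<open>R = {}\<close> e(2) unfolding L_def by blast
        then show ?thesis using Lin[of p] by simp
      qed
      moreover have "(- rot (v - u)) \<bullet> u = (- rot (v - u)) \<bullet> v" using Lin[of v] Guv by simp
      ultimately have "hull_edge V u v" unfolding hull_edge_def using V ne by blast
      then show False using chord by blast
    qed
    have sub: "\<exists>A'. disjoint_compatible A A'" if A: "A \<subseteq> E" "even (card A)" "A \<noteq> E" for A
    proof (rule less.hyps)
      show "card A < card E" using A finite_E by (meson psubsetI psubset_card_mono)
      show "disjoint_segments A" by (rule disjoint_segments_subset[OF less.prems(1) A(1)])
      show "even (card A)" by (rule A)
      show "\<exists>p\<in>e. hull_vertex (\<Union>A) p" if e: "e \<in> A" for e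
      proof -
        obtain p where p: "p \<in> e" "hull_vertex V p" using on_hull[of e] e A by blast
        have "hull_vertex (\<Union>A) p" by (rule hull_vertex_subset[OF p(2)]) (use e p A in auto)
        then show ?thesis using p by blast
      qed
    qed
    have combine: ?thesis
      if AC: "E = A \<union> C" and ev: "even (card A)" "even (card C)" and nE: "A \<noteq> E" "C \<noteq> E"
        and pos: "\<And>p. p \<in> \<Union>A \<Longrightarrow> l \<bullet> p > c" and neg: "\<And>p. p \<in> \<Union>C \<Longrightarrow> l \<bullet> p \<le> c" for A C l c
    proof -
      obtain A' where A': "disjoint_compatible A A'" using sub[of A] AC ev nE by blast
      obtain C' where C': "disjoint_compatible C C'" using sub[of C] AC ev nE by blast
      have "disjoint_compatible (A \<union> C) (A' \<union> C')" by (rule disjoint_compatible_Un[OF A' C' pos neg])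
      then show ?thesis using AC by blast
    qed
    show ?thesis
    proof (cases "even (card L)")
      case True
      have evC: "even (card (insert {u, v} R))" using even cardE True uvLR finLR by simp
      show ?thesis
      proof (rule combine[of L "insert {u, v} R" "rot (v - u) \<bullet> u" "rot (v - u)"])
        show "E = L \<union> insert {u, v} R" using E_eq by blast
        show "L \<noteq> E" using uvLR chord(1) by blast
        show "insert {u, v} R \<noteq> E" using L_ne LR uvLR(1) unfolding L_def by blast
        show "rot (v - u) \<bullet> p > rot (v - u) \<bullet> u" if "p \<in> \<Union>L" for p
          using that Lin[of p] unfolding L_def by auto
        show "rot (v - u) \<bullet> p \<le> rot (v - u) \<bullet> u" if "p \<in> \<Union>(insert {u, v} R)" for p
          using that Lin[of p] Guv unfolding R_def by force
      qed (use True evC in auto)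
    next
      case False
      then have evR: "even (card R)" using even cardE by simp
      have evC: "even (card (insert {u, v} L))" using False uvLR finLR by simp
      show ?thesis
      proof (rule combine[of R "insert {u, v} L" "- rot (v - u) \<bullet> u" "- rot (v - u)"])
        show "E = R \<union> insert {u, v} L" using E_eq by blast
        show "R \<noteq> E" using uvLR chord(1) by blast
        show "insert {u, v} L \<noteq> E" using R_ne LR uvLR(2) unfolding R_def by blast
        show "- rot (v - u) \<bullet> p > - rot (v - u) \<bullet> u" if "p \<in> \<Union>R" for p
          using that Lin[of p] unfolding R_def by auto
        show "- rot (v - u) \<bullet> p \<le> - rot (v - u) \<bullet> u" if "p \<in> \<Union>(insert {u, v} L)" for p
          using that Lin[of p] Guv unfolding L_def by force
      qed (use evR evC in auto)
    qed
  qed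
qed

section \<open>Translation to geometric graphs\<close>

lemma collinear_if_cross2_0:
  assumes "cross2 (b - a) (c - a) = 0"
  shows "collinear {a, b, c}"
proof (cases "b = a")
  case True
  then show ?thesis by simp
next
  case False
  define l where "l = b - a"
  have c0: "l $ 1 * (c - a) $ 2 = l $ 2 * (c - a) $ 1" using assms by (simp add: cross2_def l_def)
  have "l $ 1 \<noteq> 0 \<or> l $ 2 \<noteq> 0" using False by (simp add: l_def vec2_eq_iff)
  then have "\<exists>t. c - a = t *\<^sub>R l"
  proof
    assume n: "l $ 1 \<noteq> 0"
    have "c - a = ((c - a) $ 1 / l $ 1) *\<^sub>R l" using n c0 by (simp add: vec2_eq_iff field_simps)
    then show ?thesis by blast
  next
    assume n: "l $ 2 \<noteq> 0"
    have "c - a = ((c - a) $ 2 / l $ 2) *\<^sub>R l" using n c0 by (simp add: vec2_eq_iff field_simps)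
    then show ?thesis by blast
  qed
  then obtain t where "c - a = t *\<^sub>R (b - a)" unfolding l_def by blast
  then have "collinear {0, b - a, c - a}" by (simp add: collinear_lemma)
  then have "collinear {b, a, c}" by (simp add: collinear_3[of b a c])
  then show ?thesis by (simp add: insert_commute)
qed

lemma general_position_in_gen_pos: "general_position V \<Longrightarrow> in_gen_pos V"
  unfolding in_gen_pos_def
proof (intro ballI impI notI)
  fix a b c assume gp: "general_position V" and "a \<in> V" "b \<in> V" "c \<in> V" "a \<noteq> b" "a \<noteq> c" "b \<noteq> c"
    and c0: "cross2 (b - a) (c - a) = 0"
  then have "{a, b, c} \<subseteq> V" "card {a, b, c} = 3" by auto
  then show False using gp collinear_if_cross2_0[OF c0] unfolding general_position_def by blast
qed

text \<open>Carries the frontier condition from the union of the segments to the finite vertex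
  set.\<close>

lemma convex_hull_Union_segments:
  "convex hull (\<Union>f\<in>S. edge_segment f) = convex hull (\<Union>S)"
proof
  have "(\<Union>f\<in>S. edge_segment f) \<subseteq> convex hull (\<Union>S)"
    unfolding edge_segment_def by (intro UN_least hull_mono) blast
  then show "convex hull (\<Union>f\<in>S. edge_segment f) \<subseteq> convex hull (\<Union>S)"
    by (rule hull_minimal) simp
  have "\<Union>S \<subseteq> (\<Union>f\<in>S. edge_segment f)"
    unfolding edge_segment_def using hull_subset by fast
  then show "convex hull (\<Union>S) \<subseteq> convex hull (\<Union>f\<in>S. edge_segment f)" by (rule hull_mono)
qed

theorem theorem13:
  fixes M :: geo_graph
  assumes "perfect_matching M"
    and "even (card (edges M))"
    and "general_position (verts M)"
    and "convex_hull_connected (edges M)"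
  shows "\<exists>M'. perfect_matching M' \<and> edge_disjoint M' M \<and> compatible M' M"
proof -
  let ?E = "edges M"
  have gg: "geometric_graph M" and nc: "non_crossing M" and deg: "\<forall>v\<in>verts M. degree M v = 1"
    using assms(1) by (simp_all add: perfect_matching_def)
  have finV: "finite (verts M)" using gg by (simp add: geometric_graph_def)
  have pair: "\<exists>p\<in>verts M. \<exists>q\<in>verts M. p \<noteq> q \<and> e = {p, q}" if "e \<in> ?E" for e
    using gg that unfolding geometric_graph_def by blast
  \<comment> \<open>Degree one excludes isolated vertices, so the vertex set can be recovered from
    the edges.\<close>
  have UE: "\<Union>?E = verts M"
  proof
    show "\<Union>?E \<subseteq> verts M" using pair by blast
    show "verts M \<subseteq> \<Union>?E"
    proof
      fix v assume "v \<in> verts M"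
      then have "card {e \<in> ?E. v \<in> e} = 1" using deg by (simp add: degree_def)
      then have "{e \<in> ?E. v \<in> e} \<noteq> {}" by force
      then show "v \<in> \<Union>?E" by blast
    qed
  qed
  have gp: "in_gen_pos (\<Union>?E)" using general_position_in_gen_pos[OF assms(3)] UE by simp
  have ds: "disjoint_segments ?E"
  proof
    show "finite ?E" using finV UE by (metis finite_UnionD)
    show "\<exists>p q. p \<noteq> q \<and> e = {p, q}" if "e \<in> ?E" for e using pair[OF that] by blast
    show "edge_segment e \<inter> edge_segment f = {}" if "e \<in> ?E" "f \<in> ?E" "e \<noteq> f" for e f
      by (rule perfect_matching_disjoint_segments[OF assms(1) that])
  qed (rule gp)
  have "\<exists>p\<in>e. hull_vertex (\<Union>?E) p" if e: "e \<in> ?E" for e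
  proof -
    obtain p where p: "p \<in> e" "p \<in> frontier (convex hull (\<Union>?E))"
      using assms(4) e unfolding convex_hull_connected_def convex_hull_Union_segments by blast
    have "finite (\<Union>?E)" "p \<in> \<Union>?E" using finV UE p e by auto
    then show ?thesis using frontier_hull_vertex[OF _ gp _ p(2)] p(1) by blast
  qed
  then obtain E' where E': "disjoint_compatible ?E E'"
    using convex_hull_connected_disjoint_compatible[OF ds assms(2)] by blast
  have pair': "\<exists>p\<in>verts M. \<exists>q\<in>verts M. p \<noteq> q \<and> e = {p, q}" if "e \<in> E'" for e
    using disjoint_compatibleD(1)[OF E', of e] that unfolding UE by simp
  have uniq: "\<exists>!e. e \<in> E' \<and> v \<in> e" if "v \<in> verts M" for v
    using disjoint_compatibleD(2)[OF E'] that unfolding UE .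
  have cross: "edge_segment e \<inter> edge_segment f \<subseteq> e \<inter> f" if "e \<in> ?E \<union> E'" "f \<in> ?E \<union> E'" "e \<noteq> f" for e f
    by (rule disjoint_compatibleD(4)[OF E' that])
  let ?M' = "\<lparr>verts = verts M, edges = E'\<rparr>"
  have gg': "geometric_graph ?M'" unfolding geometric_graph_def using finV pair' by simp
  have nc': "non_crossing ?M'" unfolding non_crossing_def using cross by simp
  have "degree ?M' v = 1" if v: "v \<in> verts M" for v
  proof -
    obtain e where "e \<in> E'" "v \<in> e" "\<And>f. f \<in> E' \<Longrightarrow> v \<in> f \<Longrightarrow> f = e" using uniq[OF v] by blast
    then have "{e \<in> E'. v \<in> e} = {e}" by blast
    then show ?thesis by (simp add: degree_def)
  qed
  then have "perfect_matching ?M'" using gg' nc' by (simp add: perfect_matching_def)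
  moreover have "edge_disjoint ?M' M"
    using disjoint_compatibleD(3)[OF E'] by (auto simp: edge_disjoint_def)
  moreover have "non_crossing (graph_union ?M' M)"
    unfolding non_crossing_def graph_union_def using cross by auto
  then have "compatible ?M' M"
    using gg gg' nc nc' by (simp add: compatible_def)
  ultimately show ?thesis by blast
qed

end
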